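(* Let $\alpha\in(0,2)$ and let $X$ be a strictly $\alpha$-stable process on $\mathbb{R}$ (as defined in the context) with positivity coefficient $\rho\in(0,1]\setminus\{1/\alpha\}$. Then for every $\theta>0$ $$ \frac{\sin(\rho\alpha\pi)}{\pi}\int_0^\infty\frac1{x+\theta}\,\frac{x^\alpha\,\widehat\kappa(1,x)}{x^{2\alpha}+2x^\alpha\cos(\rho\alpha\pi)+1}\,dx=\frac1{\kappa(1,\theta)} . $$
   Context: Let $\alpha\in(0,2)$ and $\beta\in[-1,1]$, with $\beta=0$ if $\alpha=1$. The strictly $\alpha$-stable process $X=(X_t)_{t\ge0}$ is the real Lévy process with $$\mathbb{E}^0 e^{izX_t}=\exp\left[-t|z|^\alpha\left(1-i\beta\tan\frac{\pi\alpha}{2}\operatorname{sgn}z\right)\right],\quad z\in\mathbb{R}$$ (for $\alpha=1$, $\beta=0$ the term containing $\beta$ is read as $0$), where $\mathbb{P}^0,\mathbb{E}^0$ refer to $X_0=0$. The positivity coefficient is $\rho=\mathbb{P}^0(X_t\ge0)=\frac12+\frac1{\pi\alpha}\arctan\left(\beta\tan\frac{\pi\alpha}2\right)$ (so $\rho=\frac12$ if $\alpha=1$). $\kappa(\eta,\theta)$ denotes the bivariate Laplace exponent of the ascending ladder process (ladder time and ladder height) of $X$, normalized by $\kappa(1,0)=1$; explicitly, for $\eta>0$, $\theta\ge0$, $$\kappa(\eta,\theta)=\exp\left(\int_0^\infty\int_{(0,\infty)}\frac{e^{-t}-e^{-\eta t-\theta x}}{t}\,\mathbb{P}^0(X_t\in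 dx)\,dt\right).$$ $\widehat\kappa$ denotes the same object for the dual process $\widehat X=-X$ (replace $X_t$ by $-X_t$ in the formula).
   Formalization: The characteristic exponent of X is divided by sqrt(1+β² tan²(πα/2)), so that it has modulus |z|^α; with the scale given in the context the identity fails whenever β≠0 (e.g. α=1/2, β=1, θ=1 gives 1/2 versus 1/(1+√2)). *)

theory Defs
  imports "HOL-Probability.Probability"
begin

text \<open>
  Processes are indexed by all reals, but only the times \<open>t \<ge> 0\<close> matter.
\<close>

definition levy_process :: "'a measure \<Rightarrow> (real \<Rightarrow> 'a \<Rightarrow> real) \<Rightarrow> bool" where
  "levy_process M X \<longleftrightarrow>
     prob_space M \<and>
     (\<forall>t\<ge>0. X t \<in> borel_measurable M) \<and>
     (AE \<omega> in M. X 0 \<omega> = 0) \<and>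
     (\<forall>(n::nat) (s::nat \<Rightarrow> real). 0 \<le> s 0 \<and> (\<forall>i<n. s i \<le> s (Suc i)) \<longrightarrow>
        prob_space.indep_vars M (\<lambda>_. borel) (\<lambda>i \<omega>. X (s (Suc i)) \<omega> - X (s i) \<omega>) {..<n}) \<and>
     (\<forall>s\<ge>0. \<forall>t\<ge>0. distr M borel (\<lambda>\<omega>. X (s + t) \<omega> - X s \<omega>) = distr M borel (X t)) \<and>
     (AE \<omega> in M.
        (\<forall>t\<ge>0. ((\<lambda>s. X s \<omega>) \<longlongrightarrow> X t \<omega>) (at_right t)) \<and>
        (\<forall>t>0. \<exists>l. ((\<lambda>s. X s \<omega>) \<longlongrightarrow> l) (at_left t)))"

text \<open>
  The exponent is \<open>c |z|\<^sup>\<alpha> (1 - \<i> \<beta> tan (\<pi>\<alpha>/2) sgn z)\<close> with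
  \<open>c = 1 / sqrt (1 + (\<beta> tan (\<pi>\<alpha>/2))\<^sup>2)\<close>.  The constant \<open>c\<close>, which is \<open>1\<close> for \<open>\<beta> = 0\<close>,
  fixes the time scale so that the exponent has modulus \<open>|z|\<^sup>\<alpha>\<close>, i.e. equals
  \<open>|z|\<^sup>\<alpha> exp (- \<i> \<pi> \<alpha> (\<rho> - 1/2) sgn z)\<close> with \<open>\<rho>\<close> the positivity coefficient.
  Formulas for \<open>\<kappa>(1, \<theta>)\<close> depend on this scale: for \<open>\<alpha> < 1\<close> and \<open>\<beta> = 1\<close> one has
  \<open>\<kappa>(1, \<theta>) = 1 + \<theta>\<^sup>\<alpha>\<close> here, but \<open>1 + \<theta>\<^sup>\<alpha> / cos (\<pi>\<alpha>/2)\<close> if \<open>c\<close> is replaced by \<open>1\<close>.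
  For \<open>\<alpha> = 1\<close>, \<open>\<beta> = 0\<close> the term with \<open>\<beta>\<close> vanishes.
\<close>

definition stable_exponent :: "real \<Rightarrow> real \<Rightarrow> real \<Rightarrow> complex" where
  "stable_exponent \<alpha> \<beta> z =
     of_real (\<bar>z\<bar> powr \<alpha> / sqrt (1 + (\<beta> * tan (pi * \<alpha> / 2))\<^sup>2)) *
     (1 - \<i> * of_real (\<beta> * tan (pi * \<alpha> / 2) * sgn z))"

definition strictly_stable_process ::
    "real \<Rightarrow> real \<Rightarrow> 'a measure \<Rightarrow> (real \<Rightarrow> 'a \<Rightarrow> real) \<Rightarrow> bool" where
  "strictly_stable_process \<alpha> \<beta> M X \<longleftrightarrow>
     0 < \<alpha> \<and> \<alpha> < 2 \<and> - 1 \<le> \<beta> \<and> \<beta> \<le> 1 \<and> (\<alpha> = 1 \<longrightarrow> \<beta> = 0) \<and>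
     levy_process M X \<and>
     (\<forall>t\<ge>0. \<forall>z. char (distr M borel (X t)) z = exp (- (of_real t * stable_exponent \<alpha> \<beta> z)))"

text \<open>
  For strictly stable processes \<open>P(X\<^sub>t \<ge> 0)\<close> is the same for all \<open>t > 0\<close>, because
  \<open>X\<^sub>t\<close> and \<open>t\<^bsup>1/\<alpha>\<^esup> X\<^sub>1\<close> have the same law.
\<close>

definition positivity_coefficient :: "'a measure \<Rightarrow> (real \<Rightarrow> 'a \<Rightarrow> real) \<Rightarrow> real" where
  "positivity_coefficient M X = measure M {\<omega> \<in> space M. X 1 \<omega> \<ge> 0}"

text \<open>
  Bivariate Laplace exponent of the ascending ladder process, normalised by
  \<open>\<kappa>(1, 0) = 1\<close> and given by Fristedt's formula, for \<open>\<eta> > 0\<close> and \<open>\<theta> \<ge> 0\<close>.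
\<close>

definition ladder_exponent ::
    "'a measure \<Rightarrow> (real \<Rightarrow> 'a \<Rightarrow> real) \<Rightarrow> real \<Rightarrow> real \<Rightarrow> real" where
  "ladder_exponent M X \<eta> \<theta> =
     exp (LBINT t:{0<..}. (LINT x:{0<..}|distr M borel (X t).
       (exp (- t) - exp (- \<eta> * t - \<theta> * x)) / t))"

definition dual_process :: "(real \<Rightarrow> 'a \<Rightarrow> real) \<Rightarrow> real \<Rightarrow> 'a \<Rightarrow> real" where
  "dual_process X = (\<lambda>t \<omega>. - X t \<omega>)"

end

(*
Let Y be X at an independent standard exponential time, so that the law of Y has the
characteristic function 1 / (1 + Psi) with Psi the Levy exponent. Adding the two integrals that
define ln kappa(1, .) and ln kappa^(1, .) on the imaginary axis gives the Wiener-Hopf factorization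
kappa(1, -iz) kappa^(1, iz) = 1 + Psi(z), z > 0. Hence 1 / kappa(1, .), which is holomorphic in the
right half-plane, continues to the lower left quadrant as
  kappa^(1, w) / (1 + w^alpha exp(-i pi alpha rho)) at the point -w,
the denominator having no zero because alpha rho < 1. Scaling bounds the growth of both kappas in the
right half-plane, so that the continued function decays like a negative power. Cauchy's formula for
1 / kappa(1, .) on a rectangle in the right half-plane expresses 1 / kappa(1, theta) through the values
on the imaginary axis, and Cauchy's theorem in the quadrant moves that integral to the cut, where the
imaginary part of the continuation is the stated density.
*)
theory Submission
  imports Defs "HOL-Complex_Analysis.Complex_Analysis"
begin

section \<open>Parameter integrals\<close>

text \<open>The laws of \<open>X t\<close> have no explicit densities, while \<open>char N\<close>
  is simply 1 / (1 + symbol). Moments of \<open>Y\<close> may be infinite, so its estimates are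
  drawn from \<open>char N\<close> through the Cauchy kernel 1 / (1 + y^2). They give the exponent
  \<alpha>/2 at 0, which suffices for convergence of \<open>log_kappa\<close>. At infinity the
  exponents matter. The continued function is the dual kappa over a term of order |w|^\<alpha>, so
  the dual kappa has to grow strictly slower than |w|^\<alpha>. On the positive axis its growth
  exponent is at most \<alpha> P(Y < 0), and a bound for the oscillation of \<open>log_kappa\<close>
  between w and |w|, uniform in |w|, carries this to the half-plane. For 1 / kappa any positive
  decay exponent will do. The angle of the formula first appears as pi \<alpha> / 2 + \<gamma>, from
  rotating the symbol; that it equals pi \<alpha> \<rho> is Zolotarev's formula for P(Y > 0). The
  range of the skewness forces \<alpha> \<rho> \<le> 1, and for \<alpha> \<rho> = 1 the denominator
  would vanish at w = 1, on the cut itself.\<close>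

lemma continuous_on_integral_dominated:
  fixes f :: "'b::metric_space \<Rightarrow> 'a \<Rightarrow> complex"
  assumes meas: "\<And>w. w \<in> S \<Longrightarrow> f w \<in> borel_measurable M"
    and cont: "\<And>x. x \<in> space M \<Longrightarrow> continuous_on S (\<lambda>w. f w x)"
    and g: "integrable M g" "\<And>w x. w \<in> S \<Longrightarrow> x \<in> space M \<Longrightarrow> norm (f w x) \<le> g x"
  shows "continuous_on S (\<lambda>w. \<integral>x. f w x \<partial>M)"
  unfolding continuous_on_sequentially comp_def
proof (intro allI ballI impI)
  fix u a assume a: "a \<in> S" and u: "(\<forall>n. u n \<in> S) \<and> u \<longlonglongrightarrow> a"
  show "(\<lambda>n. \<integral>x. f (u n) x \<partial>M) \<longlonglongrightarrow> (\<integral>x. f a x \<partial>M)"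
  proof (rule integral_dominated_convergence[OF _ _ g(1)])
    show "AE x in M. (\<lambda>n. f (u n) x) \<longlonglongrightarrow> f a x"
    proof (intro AE_I2)
      fix x assume "x \<in> space M"
      then show "(\<lambda>n. f (u n) x) \<longlonglongrightarrow> f a x"
        using cont[of x] a u unfolding continuous_on_sequentially comp_def by auto
    qed
  qed (use a u meas g in auto)
qed

text \<open>Cauchy's inequality converts the bound \<open>g\<close> for the functions into a bound
  \<open>g x / r\<close> for their derivatives near \<open>w0\<close>. The difference quotients are
  then dominated, and differentiation passes under the integral.\<close>

lemma holomorphic_on_integral_dominated:
  fixes f :: "complex \<Rightarrow> 'a \<Rightarrow> complex"
  assumes "open A"
    and meas: "\<And>w. w \<in> A \<Longrightarrow> f w \<in> borel_measurable M"
    and hol: "\<And>x. x \<in> space M \<Longrightarrow> (\<lambda>w. f w x) holomorphic_on A"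
    and g: "integrable M g" "\<And>w x. w \<in> A \<Longrightarrow> x \<in> space M \<Longrightarrow> norm (f w x) \<le> g x"
  shows "(\<lambda>w. \<integral>x. f w x \<partial>M) holomorphic_on A"
  unfolding holomorphic_on_open[OF \<open>open A\<close>]
proof
  fix w0 assume w0: "w0 \<in> A"
  obtain r0 where r0: "r0 > 0" "cball w0 r0 \<subseteq> A"
    using \<open>open A\<close> w0 open_contains_cball by blast
  \<comment> \<open>Half the radius, so that the disc of radius \<open>r\<close> around any point of
    \<open>ball w0 r\<close> remains inside \<open>A\<close>; Cauchy's inequality is applied on
    these discs.\<close>
  define r where "r = r0 / 2"
  have r: "r > 0" "\<And>u. u \<in> ball w0 r \<Longrightarrow> cball u r \<subseteq> A"
  proof -
    show "r > 0" using r0 by (simp add: r_def)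
    fix u assume u: "u \<in> ball w0 r"
    show "cball u r \<subseteq> A"
    proof
      fix v assume "v \<in> cball u r"
      then have "dist w0 v \<le> r0" using u dist_triangle[of w0 v u] by (simp add: r_def)
      then show "v \<in> A" using r0 by auto
    qed
  qed
  have bA: "ball w0 r \<subseteq> A" using r0 by (auto simp: r_def)
  have lip: "norm (f u x - f w0 x) \<le> g x / r * norm (u - w0)"
    if u: "u \<in> ball w0 r" and x: "x \<in> space M" for u x
  proof (rule field_differentiable_bound[where S = "ball w0 r" and f' = "deriv (\<lambda>w. f w x)"])
    fix z assume z: "z \<in> ball w0 r"
    show "((\<lambda>w. f w x) has_field_derivative deriv (\<lambda>w. f w x) z) (at z within ball w0 r)"
      using holomorphic_derivI[OF hol[OF x] \<open>open A\<close>] z bA by blast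
    have "norm ((deriv ^^ 1) (\<lambda>w. f w x) z) \<le> fact 1 * g x / r ^ 1"
    proof (rule Cauchy_inequality)
      show "(\<lambda>w. f w x) holomorphic_on ball z r"
        using holomorphic_on_subset[OF hol[OF x]] r(2)[OF z] by (meson ball_subset_cball order_trans)
      show "continuous_on (cball z r) (\<lambda>w. f w x)"
        using holomorphic_on_imp_continuous_on[OF holomorphic_on_subset[OF hol[OF x] r(2)[OF z]]] .
      show "norm (f v x) \<le> g x" if "norm (z - v) = r" for v
        using g(2)[OF _ x] r(2)[OF z] that by (auto simp: dist_norm subset_iff)
    qed (use r in auto)
    then show "norm (deriv (\<lambda>w. f w x) z) \<le> g x / r" by simp
  qed (use u r in auto)
  define D where "D = (\<lambda>x. deriv (\<lambda>w. f w x) w0)"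
  have quot: "(\<lambda>n. (f (s n) x - f w0 x) / (s n - w0)) \<longlonglongrightarrow> D x"
    if s: "s \<longlonglongrightarrow> w0" "\<And>n. s n \<noteq> w0" and x: "x \<in> space M" for s x
  proof -
    have "((\<lambda>w. f w x) has_field_derivative D x) (at w0)"
      unfolding D_def using holomorphic_derivI[OF hol[OF x] \<open>open A\<close> w0] .
    then have "((\<lambda>w. (f w x - f w0 x) / (w - w0)) \<longlongrightarrow> D x) (at w0)"
      by (simp add: has_field_derivative_iff)
    then show ?thesis
      using s unfolding tendsto_at_iff_sequentially comp_def by auto
  qed
  \<comment> \<open>Measurability in \<open>x\<close> comes from a pointwise limit of difference
    quotients along one fixed sequence; the offset \<open>n + 2\<close> keeps this sequence strictly
    inside the ball from the start.\<close>
  have Dm: "D \<in> borel_measurable M"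
  proof -
    define s where "s n = w0 + of_real (r / (real n + 2))" for n
    have s1: "s \<longlonglongrightarrow> w0"
    proof -
      have "(\<lambda>n. r / (real n + 2)) \<longlonglongrightarrow> 0" by real_asymp
      then have "(\<lambda>n. w0 + of_real (r / (real n + 2))) \<longlonglongrightarrow> w0 + of_real 0"
        by (intro tendsto_intros)
      then show ?thesis by (simp only: s_def[abs_def] of_real_0 add_0_right)
    qed
    have s2: "s n \<noteq> w0" "s n \<in> ball w0 r" for n
    proof -
      have p: "0 < r / (real n + 2)" "r / (real n + 2) < r" using r by (simp_all add: field_simps add_pos_nonneg)
      have "norm (s n - w0) = r / (real n + 2)"
        unfolding s_def using p(1) by (simp only: add_diff_cancel_left' norm_of_real abs_of_pos)
      then show "s n \<noteq> w0" "s n \<in> ball w0 r"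
        using p by (auto simp: dist_norm norm_minus_commute)
    qed
    show ?thesis
    proof (rule borel_measurable_LIMSEQ_metric)
      show "(\<lambda>x. (f (s n) x - f w0 x) / (s n - w0)) \<in> borel_measurable M" for n
        using meas[of "s n"] meas[of w0] s2[of n] bA w0 by (intro borel_measurable_divide borel_measurable_diff) auto
      show "(\<lambda>n. (f (s n) x - f w0 x) / (s n - w0)) \<longlonglongrightarrow> D x" if "x \<in> space M" for x
        by (rule quot[OF s1 s2(1) that])
    qed
  qed
  have int: "integrable M (f w)" if "w \<in> A" for w
    by (rule Bochner_Integration.integrable_bound[OF g(1) meas[OF that]])
      (use g(2)[OF that] in \<open>auto intro!: AE_I2 order_trans[OF _ abs_ge_self]\<close>)
  have "((\<lambda>w. ((\<integral>x. f w x \<partial>M) - (\<integral>x. f w0 x \<partial>M)) / (w - w0)) \<longlongrightarrow> (\<integral>x. D x \<partial>M)) (at w0)"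
    unfolding tendsto_at_iff_sequentially comp_def
  proof (intro allI impI)
    fix s assume s1: "\<forall>i. s i \<in> UNIV - {w0}" and s2: "s \<longlonglongrightarrow> w0"
    have "eventually (\<lambda>n. s n \<in> ball w0 r) sequentially"
      using s2 r by (intro topological_tendstoD) auto
    then obtain n0 where n0: "\<And>n. n \<ge> n0 \<Longrightarrow> s n \<in> ball w0 r"
      by (auto simp: eventually_sequentially)
    define t where "t n = s (n + n0)" for n
    have t: "t n \<in> ball w0 r" "t n \<noteq> w0" "t \<longlonglongrightarrow> w0" for n
      using n0[of "n + n0"] s1 LIMSEQ_ignore_initial_segment[OF s2, of n0] by (auto simp: t_def[abs_def])
    have "(\<lambda>n. \<integral>x. (f (t n) x - f w0 x) / (t n - w0) \<partial>M) \<longlonglongrightarrow> (\<integral>x. D x \<partial>M)"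
    proof (rule integral_dominated_convergence[where w = "\<lambda>x. g x / r"])
      show "AE x in M. (\<lambda>n. (f (t n) x - f w0 x) / (t n - w0)) \<longlonglongrightarrow> D x"
        using quot[OF t(3) t(2)] by (intro AE_I2)
      show "AE x in M. norm ((f (t n) x - f w0 x) / (t n - w0)) \<le> g x / r" for n
      proof (intro AE_I2)
        fix x assume "x \<in> space M"
        then show "norm ((f (t n) x - f w0 x) / (t n - w0)) \<le> g x / r"
          using lip[OF t(1)[of n], of x] t(2)[of n] by (simp add: norm_divide divide_le_eq)
      qed
      show "(\<lambda>x. (f (t n) x - f w0 x) / (t n - w0)) \<in> borel_measurable M" for n
        using meas[of "t n"] meas[of w0] t(1,2)[of n] bA w0 by (intro borel_measurable_divide borel_measurable_diff) auto
    qed (use g Dm in auto)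
    moreover have "(\<integral>x. (f (t n) x - f w0 x) / (t n - w0) \<partial>M)
        = ((\<integral>x. f (t n) x \<partial>M) - (\<integral>x. f w0 x \<partial>M)) / (t n - w0)" for n
      using int[of "t n"] int[OF w0] t(1,2)[of n] bA by (subst Bochner_Integration.integral_diff[symmetric]) auto
    ultimately have "(\<lambda>n. ((\<integral>x. f (t n) x \<partial>M) - (\<integral>x. f w0 x \<partial>M)) / (t n - w0)) \<longlonglongrightarrow> (\<integral>x. D x \<partial>M)"
      by (simp only:)
    then show "(\<lambda>n. ((\<integral>x. f (s n) x \<partial>M) - (\<integral>x. f w0 x \<partial>M)) / (s n - w0)) \<longlonglongrightarrow> (\<integral>x. D x \<partial>M)"
      unfolding t_def by (rule LIMSEQ_offset)
  qed
  then show "\<exists>f'. ((\<lambda>w. \<integral>x. f w x \<partial>M) has_field_derivative f') (at w0)"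
    by (auto simp: has_field_derivative_iff)
qed

section \<open>Exponential integrals and the Cauchy kernel\<close>

lemma LBINT_FTC_Ioi:
  fixes f F :: "real \<Rightarrow> 'a::euclidean_space"
  assumes "\<And>x. x > a \<Longrightarrow> (F has_vector_derivative f x) (at x)" "\<And>x. x > a \<Longrightarrow> isCont f x"
    and "set_integrable lborel {a<..} f" "(F \<longlongrightarrow> A) (at_right a)" "(F \<longlongrightarrow> B) at_top"
  shows "(LBINT x:{a<..}. f x) = B - A"
proof -
  have "(LBINT x=ereal a..\<infinity>. f x) = B - A"
    by (rule interval_integral_FTC_integrable[where F = F])
      (use assms in \<open>auto simp: ereal_tendsto_simps\<close>)
  then show ?thesis by (simp add: interval_integral_to_infinity_eq)
qed

lemma set_integrable_exp_minus:
  fixes c :: complex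
  assumes "Re c > 0"
  shows "set_integrable lborel {0<..} (\<lambda>t. exp (- c * of_real t))"
  unfolding set_integrable_def
proof (rule Bochner_Integration.integrable_bound)
  show "integrable lborel (\<lambda>t. indicator {0<..} t *\<^sub>R exp (- (t * Re c)))"
    using integrable_I0i_exp_mscale[OF assms] by (simp add: set_integrable_def)
  show "AE x in lborel. norm (indicat_real {0<..} x *\<^sub>R exp (- c * of_real x))
      \<le> norm (indicat_real {0<..} x *\<^sub>R exp (- (x * Re c)))"
    by (auto simp: indicator_def mult.commute)
qed measurable

lemma LBINT_exp_minus:
  fixes c :: complex
  assumes "Re c > 0"
  shows "(LBINT t:{0<..}. exp (- c * of_real t)) = 1 / c"
proof -
  have c: "c \<noteq> 0" using assms by auto
  have "(LBINT t:{0<..}. exp (- c * of_real t)) = 0 - (- 1 / c)"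
  proof (rule LBINT_FTC_Ioi[where F = "\<lambda>t. - exp (- c * of_real t) / c"])
    show "((\<lambda>t. - exp (- c * of_real t) / c) has_vector_derivative exp (- c * of_real x)) (at x)" for x
      using c by (auto intro!: derivative_eq_intros has_vector_derivative_real_field)
    have "((\<lambda>t. exp (- (Re c * t))) \<longlongrightarrow> 0) at_top"
      using assms by real_asymp
    then have "((\<lambda>t. norm (exp (- c * of_real t))) \<longlongrightarrow> 0) at_top" by simp
    then have "((\<lambda>t. exp (- c * of_real t)) \<longlongrightarrow> 0) at_top" by (rule tendsto_norm_zero_cancel)
    then have "((\<lambda>t. - exp (- c * of_real t) / c) \<longlongrightarrow> - 0 / c) at_top"
      using c by (intro tendsto_intros)
    then show "((\<lambda>t. - exp (- c * of_real t) / c) \<longlongrightarrow> 0) at_top" by simp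
    have "((\<lambda>t. - exp (- c * of_real t) / c) \<longlongrightarrow> - exp (- c * of_real 0) / c) (at_right 0)"
      using c by (intro tendsto_intros)
    then show "((\<lambda>t. - exp (- c * of_real t) / c) \<longlongrightarrow> - 1 / c) (at_right 0)" by simp
  qed (use assms set_integrable_exp_minus in auto)
  then show ?thesis by simp
qed

lemma LBINT_exp_cos:
  fixes y :: real
  shows "(LBINT t:{0<..}. exp (- t) * cos (t * y)) = 1 / (1 + y\<^sup>2)"
proof -
  define c where "c = Complex 1 (- y)"
  have 1: "Re (exp (- c * of_real t)) = exp (- t) * cos (t * y)" for t
    by (simp add: c_def Re_exp mult.commute)
  have "(LBINT t:{0<..}. exp (- t) * cos (t * y)) = Re (LBINT t:{0<..}. exp (- c * of_real t))"
    using set_integrable_exp_minus[of c]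
    by (simp add: set_lebesgue_integral_def set_integrable_def integral_Re[symmetric] c_def Re_exp mult.commute)
  also have "\<dots> = Re (1 / c)" by (subst LBINT_exp_minus) (auto simp: c_def)
  also have "\<dots> = 1 / (1 + y\<^sup>2)" by (simp add: c_def Re_divide)
  finally show ?thesis .
qed

text \<open>The kernel is the cosine transform of the exponential density, so Fubini applies. This
  is the bridge from an explicit characteristic function to the law: small \<epsilon> tests the
  tails, large \<epsilon> the atom at 0.\<close>

lemma (in real_distribution) expectation_cauchy_kernel:
  "expectation (\<lambda>x. 1 / (1 + (\<epsilon> * x)\<^sup>2)) = (LBINT z:{0<..}. exp (- z) * Re (char M (\<epsilon> * z)))"
proof -
  interpret P: pair_sigma_finite lborel M by unfold_locales
  define f where "f = (\<lambda>(z::real, x::real). indicator {0<..} z * (exp (- z) * cos (z * (\<epsilon> * x))))"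
  have [measurable]: "f \<in> borel_measurable (lborel \<Otimes>\<^sub>M M)"
    unfolding f_def by measurable
  have e: "integrable lborel (\<lambda>z::real. indicator {0<..} z * exp (- z))"
    using integrable_I0i_exp_mscale[of 1] by (simp add: set_integrable_def)
  have int: "integrable (lborel \<Otimes>\<^sub>M M) f"
  proof (rule Bochner_Integration.integrable_bound)
    show "integrable (lborel \<Otimes>\<^sub>M M) (\<lambda>(z::real, x::real). indicator {0<..} z * exp (- z))"
    proof (rule P.Fubini_integrable)
      show "(\<lambda>(z::real, x::real). indicat_real {0<..} z * exp (- z)) \<in> borel_measurable (lborel \<Otimes>\<^sub>M M)"
        by measurable
    qed (use integrable_norm[OF e] prob_space in simp_all)
    show "AE x in lborel \<Otimes>\<^sub>M M. norm (f x) \<le> norm (case x of (z, x) \<Rightarrow> indicat_real {0<..} z * exp (- z))"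
      by (auto simp: f_def abs_mult indicator_def mult_left_le)
  qed measurable
  have "(LBINT z:{0<..}. exp (- z) * Re (char M (\<epsilon> * z))) = (LBINT z. \<integral>x. f (z, x) \<partial>M)"
    unfolding set_lebesgue_integral_def
  proof (intro Bochner_Integration.integral_cong refl)
    fix z :: real
    have "Re (char M (\<epsilon> * z)) = expectation (\<lambda>x. Re (iexp (\<epsilon> * z * x)))"
      unfolding char_def by (rule integral_Re[symmetric], rule integrable_iexp) auto
    also have "\<dots> = expectation (\<lambda>x. cos (z * (\<epsilon> * x)))"
      by (simp only: cis_conv_exp[symmetric] cis.sel mult_ac)
    finally have "Re (char M (\<epsilon> * z)) = expectation (\<lambda>x. cos (z * (\<epsilon> * x)))" .
    then show "indicat_real {0<..} z *\<^sub>R (exp (- z) * Re (char M (\<epsilon> * z))) = (\<integral>x. f (z, x) \<partial>M)"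
      by (simp add: f_def)
  qed
  also have "\<dots> = (\<integral>x. (LBINT z. f (z, x)) \<partial>M)"
    using P.Fubini_integral[of "\<lambda>z x. f (z, x)"] int by simp
  also have "\<dots> = expectation (\<lambda>x. 1 / (1 + (\<epsilon> * x)\<^sup>2))"
    using LBINT_exp_cos by (intro Bochner_Integration.integral_cong refl) (simp add: f_def set_lebesgue_integral_def)
  finally show ?thesis by simp
qed

section \<open>The law at an exponential time\<close>

text \<open>The Levy exponent in polar form. For the stable process \<gamma> is the arctangent of
  \<beta> tan(pi \<alpha> / 2); the symbol is homogeneous of degree \<alpha> under positive
  scalings.\<close>

definition stable_symbol :: "real \<Rightarrow> real \<Rightarrow> real \<Rightarrow> complex" where
  "stable_symbol \<alpha> \<gamma> z = of_real (\<bar>z\<bar> powr \<alpha>) * cis (- \<gamma> * sgn z)"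

text \<open>
  With \<open>N\<close> the law of \<open>Y = X\<^sub>e\<close>, \<open>e\<close> an independent standard exponential time, \<open>positive_laplace N w\<close>
  is \<open>E[1 - exp (-w Y); Y > 0]\<close>. Writing \<open>exp (-t) / t\<close> as the integral of \<open>exp (-t v)\<close> over \<open>v \<ge> 1\<close>
  in Fristedt's formula and using the scaling property turns \<open>ln \<kappa>(1, w)\<close> into \<open>log_kappa \<alpha> N w\<close>.
\<close>

definition positive_laplace :: "real measure \<Rightarrow> complex \<Rightarrow> complex" where
  "positive_laplace N w = (LINT x:{0<..}|N. 1 - exp (- (w * of_real x)))"

definition log_kappa :: "real \<Rightarrow> real measure \<Rightarrow> complex \<Rightarrow> complex" where
  "log_kappa \<alpha> N w = (LBINT v:{1..}. positive_laplace N (w * of_real (v powr (- 1 / \<alpha>))) / of_real v)"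

text \<open>\<open>exp\<close> is 1-Lipschitz on the convex left half-plane, where its derivative
  has modulus at most 1; for large arguments the triangle inequality gives 2. The minimum has a
  finite mean even when \<open>x\<close> has none.\<close>

lemma norm_one_minus_exp_le:
  assumes "Re w \<ge> 0" "x \<ge> 0"
  shows "norm (1 - exp (- (w * of_real x))) \<le> 2 * min 1 (norm w * x)"
proof -
  have "norm (exp 0 - exp (- (w * of_real x))) \<le> 1 * norm (0 - (- (w * of_real x)))"
  proof (rule field_differentiable_bound[where S = "{z. Re z \<le> 0}" and f = exp and f' = exp])
    show "convex {z. Re z \<le> 0}" by (rule convex_halfspace_Re_le)
    show "(exp has_field_derivative exp z) (at z within {z. Re z \<le> 0})" for z :: complex
      by (rule has_field_derivative_at_within[OF DERIV_exp])
  qed (use assms in auto)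
  then have 1: "norm (1 - exp (- (w * of_real x))) \<le> norm w * x"
    using assms by (simp add: norm_mult)
  have "norm (1 - exp (- (w * of_real x))) \<le> norm (1::complex) + norm (exp (- (w * of_real x)))"
    by (rule norm_triangle_ineq4)
  also have "\<dots> \<le> 2" using assms by simp
  finally show ?thesis
    using 1 assms mult_nonneg_nonneg[of "norm w" x] by (auto simp: min_def simp del: mult_nonneg_nonneg)
qed

lemma Re_stable_symbol_nonneg:
  assumes gamma: "\<bar>\<gamma>\<bar> < pi / 2"
  shows "Re (stable_symbol \<alpha> \<gamma> z) \<ge> 0"
proof -
  have "\<bar>\<gamma> * sgn z\<bar> < pi / 2" using gamma by (auto simp: sgn_if)
  then have "cos (\<gamma> * sgn z) > 0" by (intro cos_gt_zero_pi) auto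
  then show ?thesis by (simp add: stable_symbol_def)
qed

text \<open>Reflection at 0 replaces \<gamma> by - \<gamma> and stays within the locale, so each
  estimate proved here serves both for kappa and for the dual kappa.\<close>

locale stable_exp_law = real_distribution N for N :: "real measure" +
  fixes \<alpha> \<gamma> :: real
  assumes alpha: "0 < \<alpha>" "\<alpha> < 2" and gamma: "\<bar>\<gamma>\<bar> < pi / 2"
    and char_N: "\<And>z. char N z = 1 / (1 + stable_symbol \<alpha> \<gamma> z)"
begin

lemmas Re_symbol_nonneg = Re_stable_symbol_nonneg[OF gamma, of \<alpha>]

lemma norm_symbol: "norm (stable_symbol \<alpha> \<gamma> z) = \<bar>z\<bar> powr \<alpha>"
  by (simp add: stable_symbol_def norm_mult)

lemma norm_1_symbol: "norm (1 + stable_symbol \<alpha> \<gamma> z) \<ge> 1" "1 + stable_symbol \<alpha> \<gamma> z \<noteq> 0"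
proof -
  show *: "norm (1 + stable_symbol \<alpha> \<gamma> z) \<ge> 1"
    using Re_symbol_nonneg[of z] complex_Re_le_cmod[of "1 + stable_symbol \<alpha> \<gamma> z"] by simp
  then show "1 + stable_symbol \<alpha> \<gamma> z \<noteq> 0" by auto
qed

section \<open>Truncated moments from the characteristic function\<close>

lemma norm_1_char: "norm (1 - char N z) \<le> \<bar>z\<bar> powr \<alpha>"
proof -
  have "1 - char N z = stable_symbol \<alpha> \<gamma> z / (1 + stable_symbol \<alpha> \<gamma> z)"
    using norm_1_symbol[of z] by (simp add: char_N field_simps)
  then show ?thesis
    using norm_1_symbol[of z] by (simp add: norm_divide norm_symbol divide_le_eq mult_le_cancel_left1)
qed

text \<open>The integrand is 1 minus the Cauchy kernel, so its mean is the exponential average of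
  \<open>1 - Re (char N (\<epsilon> * z))\<close>, which is at most
  \<open>(\<epsilon> * z) powr \<alpha>\<close>. Since \<alpha> < 2, \<open>z powr \<alpha>\<close>
  is below 1 + z^2, whose exponential average is 1 + 2; hence the 3.\<close>

lemma expectation_saturated_square:
  assumes "\<epsilon> \<ge> 0"
  shows "expectation (\<lambda>x. (\<epsilon> * x)\<^sup>2 / (1 + (\<epsilon> * x)\<^sup>2)) \<le> 3 * \<epsilon> powr \<alpha>"
proof -
  have m: "integrable lborel (\<lambda>z::real. indicator {0<..} z *\<^sub>R (exp (- z) * z ^ k))"
    "(LBINT z::real:{0<..}. exp (- z) * z ^ k) = fact k" for k
    using has_bochner_integral_I0i_power_exp_m[of k]
    unfolding has_bochner_integral_iff set_lebesgue_integral_def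
    by (simp_all add: mult_ac)
  have e: "set_integrable lborel {0<..} (\<lambda>z::real. exp (- z))" "(LBINT z::real:{0<..}. exp (- z)) = 1"
    using m[of 0] by (simp_all add: set_integrable_def)
  have c: "set_integrable lborel {0<..} (\<lambda>z::real. exp (- z) * Re (char N (\<epsilon> * z)))"
    unfolding set_integrable_def
    by (rule Bochner_Integration.integrable_bound[OF e(1)[unfolded set_integrable_def]])
      (auto simp: abs_mult indicator_def intro!: mult_left_le order_trans[OF abs_Re_le_cmod cmod_char_le_1])
  have b: "set_integrable lborel {0<..} (\<lambda>z::real. \<epsilon> powr \<alpha> * (exp (- z) * z ^ 0 + exp (- z) * z ^ 2))"
    using m(1)[of 0] m(1)[of 2] by (intro set_integrable_mult_right set_integral_add(1)) (simp_all add: set_integrable_def)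
  have "expectation (\<lambda>x. (\<epsilon> * x)\<^sup>2 / (1 + (\<epsilon> * x)\<^sup>2)) = expectation (\<lambda>x. 1 - 1 / (1 + (\<epsilon> * x)\<^sup>2))"
    by (intro Bochner_Integration.integral_cong refl) (simp add: field_simps add_nonneg_eq_0_iff)
  also have "\<dots> = 1 - expectation (\<lambda>x. 1 / (1 + (\<epsilon> * x)\<^sup>2))"
  proof (subst Bochner_Integration.integral_diff)
    have le1: "1 \<le> a \<Longrightarrow> norm (1 / a) \<le> 1" for a :: real by simp
    show "integrable N (\<lambda>x. 1 / (1 + (\<epsilon> * x)\<^sup>2))"
    proof (rule integrable_const_bound[where B = 1])
      have "norm (1 / (1 + (\<epsilon> * x)\<^sup>2)) \<le> 1" for x
        using le1[of "1 + (\<epsilon> * x)\<^sup>2"] by simp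
      then show "AE x in N. norm (1 / (1 + (\<epsilon> * x)\<^sup>2)) \<le> 1" by blast
    qed simp
  qed (use prob_space in simp_all)
  also have "\<dots> = (LBINT z:{0<..}. exp (- z) - exp (- z) * Re (char N (\<epsilon> * z)))"
    by (subst set_integral_diff(2)[OF e(1) c]) (simp add: e expectation_cauchy_kernel)
  also have "\<dots> \<le> (LBINT z:{0<..}. \<epsilon> powr \<alpha> * (exp (- z) * z ^ 0 + exp (- z) * z ^ 2))"
  proof (rule set_integral_mono)
    fix z :: real assume z: "z \<in> {0<..}"
    have "1 - Re (char N (\<epsilon> * z)) \<le> (\<epsilon> * z) powr \<alpha>"
      using norm_1_char[of "\<epsilon> * z"] abs_Re_le_cmod[of "1 - char N (\<epsilon> * z)"] assms z by simp
    also have "\<dots> = \<epsilon> powr \<alpha> * z powr \<alpha>" using assms z by (simp add: powr_mult)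
    also have "z powr \<alpha> \<le> 1 + z\<^sup>2"
    proof (cases "z \<le> 1")
      case True
      then have "z powr \<alpha> \<le> 1" using z alpha by (simp add: powr_le1)
      then show ?thesis by (simp add: add_increasing2)
    next
      case False
      then have "z powr \<alpha> \<le> z powr 2" using alpha by (intro powr_mono) auto
      then show ?thesis using z by simp
    qed
    finally have "exp (- z) * (1 - Re (char N (\<epsilon> * z))) \<le> exp (- z) * (\<epsilon> powr \<alpha> * (1 + z\<^sup>2))"
      by (simp add: mult_left_mono)
    then show "exp (- z) - exp (- z) * Re (char N (\<epsilon> * z)) \<le> \<epsilon> powr \<alpha> * (exp (- z) * z ^ 0 + exp (- z) * z ^ 2)"
      by (simp add: algebra_simps)
  qed (use b set_integral_diff(1)[OF e(1) c] in auto)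
  also have "\<dots> = \<epsilon> powr \<alpha> * (1 + 2)"
    using m(1)[of 0] m(1)[of 2] m(2)[of 2] e(2)
    by (subst set_integral_mult_right, subst set_integral_add(2)) (simp_all add: set_integrable_def fact_numeral)
  finally show ?thesis by simp
qed

text \<open>With m the truncated value and \<delta> = \<open>\<epsilon> powr (\<alpha> / 2)\<close>,
  the inequality 2 \<delta> m \<le> \<delta>^2 + m^2 leads to the second moment, and m^2 is at most
  twice the saturated square. This \<delta> balances the two terms and gives the factor 1/2 + 3
  \<le> 4; the halved exponent is the price of the step.\<close>

lemma expectation_min_le:
  assumes "\<epsilon> \<ge> 0"
  shows "expectation (\<lambda>x. min 1 (\<epsilon> * \<bar>x\<bar>)) \<le> 4 * \<epsilon> powr (\<alpha> / 2)"
proof (cases "\<epsilon> = 0")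
  case False
  define \<delta> where "\<delta> = \<epsilon> powr (\<alpha> / 2)"
  have d: "\<delta> > 0" "\<delta> * \<delta> = \<epsilon> powr \<alpha>" using False assms by (simp_all add: \<delta>_def powr_add[symmetric])
  have aff: "expectation (\<lambda>x. a + f x / d) = a + expectation f / d" if "integrable N f" for f :: "real \<Rightarrow> real" and a d
    using that prob_space by (subst Bochner_Integration.integral_add) (auto intro!: integrable_divide_zero)
  have i: "integrable N (\<lambda>x. (\<epsilon> * x)\<^sup>2 / (1 + (\<epsilon> * x)\<^sup>2))"
    by (intro integrable_const_bound[where B = 1]) (auto simp: divide_le_eq add_nonneg_pos not_less)
  have "expectation (\<lambda>x. min 1 (\<epsilon> * \<bar>x\<bar>)) \<le> expectation (\<lambda>x. \<delta> / 2 + (\<epsilon> * x)\<^sup>2 / (1 + (\<epsilon> * x)\<^sup>2) / \<delta>)"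
  proof (rule integral_mono)
    show "integrable N (\<lambda>x. min 1 (\<epsilon> * \<bar>x\<bar>))"
      using assms by (intro integrable_const_bound[where B = 1]) auto
    show "integrable N (\<lambda>x. \<delta> / 2 + (\<epsilon> * x)\<^sup>2 / (1 + (\<epsilon> * x)\<^sup>2) / \<delta>)"
      by (intro Bochner_Integration.integrable_add integrable_divide_zero i) auto
    fix x
    define m where "m = min 1 (\<epsilon> * \<bar>x\<bar>)"
    define y where "y = \<epsilon> * \<bar>x\<bar>"
    have y: "y \<ge> 0" using assms by (simp add: y_def)
    have 1: "m\<^sup>2 \<le> 2 * (y\<^sup>2 / (1 + y\<^sup>2))"
    proof (cases "y \<le> 1")
      case True
      then have "y\<^sup>2 \<le> 1" using y by (simp add: power_le_one)
      then have "y\<^sup>2 * (1 + y\<^sup>2) \<le> y\<^sup>2 * 2" by (intro mult_left_mono) auto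
      then show ?thesis using True by (simp add: m_def y_def[symmetric] min_def le_divide_eq add_pos_nonneg mult.commute)
    next
      case False
      then have "1 \<le> y\<^sup>2" by (simp add: one_le_power)
      then show ?thesis using False by (simp add: m_def y_def[symmetric] min_def le_divide_eq add_pos_nonneg)
    qed
    have "0 \<le> (\<delta> - m)\<^sup>2" by simp
    then have "\<delta> * m \<le> \<delta> * (\<delta> / 2 + y\<^sup>2 / (1 + y\<^sup>2) / \<delta>)"
      using 1 d(1) by (simp add: power2_eq_square[of "\<delta> - m"] power2_eq_square[of m] distrib_left left_diff_distrib right_diff_distrib)
    then have "m \<le> \<delta> / 2 + y\<^sup>2 / (1 + y\<^sup>2) / \<delta>"
      using d(1) by (simp only: mult_le_cancel_left_pos)
    moreover have "y\<^sup>2 = (\<epsilon> * x)\<^sup>2" by (simp add: y_def power_mult_distrib)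
    ultimately show "min 1 (\<epsilon> * \<bar>x\<bar>) \<le> \<delta> / 2 + (\<epsilon> * x)\<^sup>2 / (1 + (\<epsilon> * x)\<^sup>2) / \<delta>"
      by (simp add: m_def)
  qed
  also have "\<dots> = \<delta> / 2 + expectation (\<lambda>x. (\<epsilon> * x)\<^sup>2 / (1 + (\<epsilon> * x)\<^sup>2)) / \<delta>"
    by (rule aff[OF i])
  also have "\<dots> \<le> \<delta> / 2 + 3 * (\<delta> * \<delta>) / \<delta>"
    using expectation_saturated_square[OF assms] d by (intro add_left_mono divide_right_mono) auto
  also have "\<dots> \<le> 4 * \<delta>" using d(1) by simp
  finally show ?thesis by (simp add: \<delta>_def)
qed auto

section \<open>Regularity of the half-line Laplace transform and of log kappa\<close>

lemma positive_laplace_alt: "positive_laplace N w = (\<integral>x. indicator {0<..} x *\<^sub>R (1 - exp (- (w * of_real x))) \<partial>N)"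
  by (simp add: positive_laplace_def set_lebesgue_integral_def)

lemma norm_positive_laplace_integrand_le:
  "Re w \<ge> 0 \<Longrightarrow> norm (indicator {0<..} x *\<^sub>R (1 - exp (- (w * of_real x)))) \<le> 2 * min 1 (norm w * \<bar>x\<bar>)"
  using norm_one_minus_exp_le[of w x] by (cases "x > 0") (auto simp: mult_nonneg_nonpos)

lemma norm_positive_laplace_integrand_le_2:
  "Re w \<ge> 0 \<Longrightarrow> norm (indicator {0<..} x *\<^sub>R (1 - exp (- (w * of_real x)))) \<le> 2"
  by (rule order_trans[OF norm_positive_laplace_integrand_le]) auto

lemma integrable_positive_laplace:
  "Re w \<ge> 0 \<Longrightarrow> integrable N (\<lambda>x. indicator {0<..} x *\<^sub>R (1 - exp (- (w * of_real x))))"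
  by (intro integrable_const_bound[where B = 2] AE_I2 norm_positive_laplace_integrand_le_2) auto

lemma norm_positive_laplace_le_2: "Re w \<ge> 0 \<Longrightarrow> norm (positive_laplace N w) \<le> 2"
  unfolding positive_laplace_alt
  by (rule order_trans[OF integral_norm_bound])
    (rule integral_le_const, auto intro!: integrable_norm integrable_positive_laplace AE_I2 norm_positive_laplace_integrand_le_2 simp del: norm_scaleR)

lemma norm_positive_laplace_le:
  assumes "Re w \<ge> 0"
  shows "norm (positive_laplace N w) \<le> 8 * norm w powr (\<alpha> / 2)"
proof -
  have "norm (positive_laplace N w) \<le> (\<integral>x. norm (indicator {0<..} x *\<^sub>R (1 - exp (- (w * of_real x)))) \<partial>N)"
    unfolding positive_laplace_alt by (rule integral_norm_bound)
  also have "\<dots> \<le> expectation (\<lambda>x. 2 * min 1 (norm w * \<bar>x\<bar>))"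
    using assms by (intro integral_mono integrable_norm integrable_positive_laplace norm_positive_laplace_integrand_le
        integrable_mult_right integrable_const_bound[where B = 1]) auto
  also have "\<dots> \<le> 8 * norm w powr (\<alpha> / 2)"
    using expectation_min_le[of "norm w"] by simp
  finally show ?thesis .
qed

lemma measurable_positive_laplace [measurable]: "positive_laplace N \<in> borel_measurable borel"
  unfolding positive_laplace_alt[abs_def] by measurable

lemma continuous_on_positive_laplace: "continuous_on {w. Re w \<ge> 0} (positive_laplace N)"
  unfolding positive_laplace_alt[abs_def]
  by (rule continuous_on_integral_dominated[where g = "\<lambda>_. 2"])
    (auto intro!: continuous_intros norm_positive_laplace_integrand_le_2 simp del: norm_scaleR)

lemma holomorphic_on_positive_laplace: "positive_laplace N holomorphic_on {w. Re w > 0}"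
  unfolding positive_laplace_alt[abs_def]
proof (rule holomorphic_on_integral_dominated[where g = "\<lambda>_. 2"])
  show "(\<lambda>w. indicator {0<..} x *\<^sub>R (1 - exp (- (w * of_real x)))) holomorphic_on {w. Re w > 0}" for x
    unfolding scaleR_conv_of_real by (intro holomorphic_intros)
qed (auto intro!: norm_positive_laplace_integrand_le_2 open_halfspace_Re_gt simp del: norm_scaleR)


lemma log_kappa_alt:
  "log_kappa \<alpha> N w = (LBINT v. indicator {1..} v *\<^sub>R (positive_laplace N (w * of_real (v powr (- 1 / \<alpha>))) / of_real v))"
  by (simp add: log_kappa_def set_lebesgue_integral_def)

lemma integrable_powr_tail: "integrable lborel (\<lambda>v::real. indicator {1..} v *\<^sub>R (v powr (- 3 / 2)))"
proof -
  have "(\<lambda>v::real. v powr (- 3 / 2)) absolutely_integrable_on {1..}"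
    using has_integral_powr_to_inf[of "- 3 / 2" 1]
    by (intro nonnegative_absolutely_integrable_1) (auto simp: integrable_on_def)
  then show ?thesis
    unfolding set_integrable_def by (subst (asm) integrable_completion) auto
qed

text \<open>Along \<open>w * of_real (v powr (- 1 / \<alpha>))\<close> the bound of order \<alpha>/2
  for \<open>positive_laplace\<close> becomes \<open>v powr (- 1 / 2)\<close>; the factor 1 / v
  makes it integrable at infinity.\<close>

lemma norm_log_kappa_integrand_le:
  assumes "Re w \<ge> 0"
  shows "norm (indicator {1..} v *\<^sub>R (positive_laplace N (w * of_real (v powr (- 1 / \<alpha>))) / of_real v))
    \<le> 8 * norm w powr (\<alpha> / 2) * (indicator {1..} v *\<^sub>R (v powr (- 3 / 2)))"
proof (cases "v \<ge> 1")
  case True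
  have "norm (positive_laplace N (w * of_real (v powr (- 1 / \<alpha>)))) \<le> 8 * norm (w * of_real (v powr (- 1 / \<alpha>))) powr (\<alpha> / 2)"
    using assms by (intro norm_positive_laplace_le) simp
  also have "\<dots> = 8 * norm w powr (\<alpha> / 2) * v powr (- 1 / 2)"
    using True alpha by (simp add: norm_mult powr_mult powr_powr)
  finally have "norm (positive_laplace N (w * of_real (v powr (- 1 / \<alpha>)))) / v \<le> 8 * norm w powr (\<alpha> / 2) * v powr (- 1 / 2) / v"
    using True by (intro divide_right_mono) auto
  then have "norm (positive_laplace N (w * of_real (v powr (- 1 / \<alpha>)))) / v \<le> 8 * norm w powr (\<alpha> / 2) * (v powr (- 1 / 2) / v)"
    by simp
  also have "v powr (- 1 / 2) / v = v powr (- 3 / 2)"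
    using True powr_diff[of v "- 1 / 2" 1] by simp
  finally show ?thesis using True by (simp add: norm_divide)
qed auto

lemma measurable_log_kappa_integrand [measurable]:
  "(\<lambda>v. indicator A v *\<^sub>R (positive_laplace N (w * of_real (v powr (- 1 / \<alpha>))) / of_real v)) \<in> borel_measurable borel"
  if [measurable]: "A \<in> sets borel"
  by measurable

lemma integrable_log_kappa:
  assumes "Re w \<ge> 0"
  shows "integrable lborel (\<lambda>v. indicator {1..} v *\<^sub>R (positive_laplace N (w * of_real (v powr (- 1 / \<alpha>))) / of_real v))"
proof (rule Bochner_Integration.integrable_bound)
  show "integrable lborel (\<lambda>v. 8 * norm w powr (\<alpha> / 2) * (indicator {1..} v *\<^sub>R (v powr (- 3 / 2))))"
    by (intro integrable_mult_right integrable_powr_tail)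
  show "AE v in lborel. norm (indicator {1..} v *\<^sub>R (positive_laplace N (w * of_real (v powr (- 1 / \<alpha>))) / of_real v))
      \<le> norm (8 * norm w powr (\<alpha> / 2) * (indicator {1..} v *\<^sub>R (v powr (- 3 / 2))))"
    by (intro AE_I2 order_trans[OF norm_log_kappa_integrand_le[OF assms]]) simp
qed simp

text \<open>The majorant grows with \<open>norm w\<close>, so dominated convergence is applied on
  bounded parts of the half-plane. Both properties are local, which allows the parts cut out by
  balls to be glued.\<close>

lemma
  shows continuous_on_log_kappa: "continuous_on {w. Re w \<ge> 0} (log_kappa \<alpha> N)"
    and holomorphic_on_log_kappa: "log_kappa \<alpha> N holomorphic_on {w. Re w > 0}"
proof -
  have g: "integrable lborel (\<lambda>v. 8 * R powr (\<alpha> / 2) * (indicator {1..} v *\<^sub>R (v powr (- 3 / 2))))" for R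
    by (intro integrable_mult_right integrable_powr_tail)
  have le: "norm (indicator {1..} v *\<^sub>R (positive_laplace N (w * of_real (v powr (- 1 / \<alpha>))) / of_real v))
      \<le> 8 * R powr (\<alpha> / 2) * (indicator {1..} v *\<^sub>R (v powr (- 3 / 2)))"
    if "Re w \<ge> 0" "norm w \<le> R" for R w v
    using that alpha by (intro order_trans[OF norm_log_kappa_integrand_le] mult_right_mono mult_left_mono powr_mono2) auto
  have c: "continuous_on ({w. Re w \<ge> 0} \<inter> ball 0 R) (log_kappa \<alpha> N)" for R
    unfolding log_kappa_alt[abs_def]
  proof (rule continuous_on_integral_dominated[OF _ _ g[of R] le])
    fix v
    show "continuous_on ({w. 0 \<le> Re w} \<inter> ball 0 R)
       (\<lambda>w. indicator {1..} v *\<^sub>R (positive_laplace N (w * of_real (v powr (- 1 / \<alpha>))) / of_real v))"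
    proof (cases "v \<ge> 1")
      case True
      then show ?thesis
        by (intro continuous_intros continuous_on_compose2[OF continuous_on_positive_laplace]) auto
    qed auto
  qed auto
  show "continuous_on {w. Re w \<ge> 0} (log_kappa \<alpha> N)"
    unfolding continuous_on_eq_continuous_within
  proof
    fix w :: complex assume w: "w \<in> {w. Re w \<ge> 0}"
    have "continuous (at w within {w. Re w \<ge> 0} \<inter> ball 0 (norm w + 1)) (log_kappa \<alpha> N)"
      using c[of "norm w + 1"] w unfolding continuous_on_eq_continuous_within by auto
    moreover have "at w within {w. Re w \<ge> 0} \<inter> ball 0 (norm w + 1) = at w within {w. Re w \<ge> 0}"
      by (rule at_within_nhd[where S = "ball 0 (norm w + 1)"]) auto
    ultimately show "continuous (at w within {w. Re w \<ge> 0}) (log_kappa \<alpha> N)" by simp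
  qed
  have o: "open ({w. Re w > 0} \<inter> ball 0 R)" for R
    by (intro open_Int open_halfspace_Re_gt open_ball)
  have "log_kappa \<alpha> N holomorphic_on ({w. Re w > 0} \<inter> ball 0 R)" for R
    unfolding log_kappa_alt[abs_def]
  proof (rule holomorphic_on_integral_dominated[OF o _ _ g[of R] le])
    fix v
    show "(\<lambda>w. indicator {1..} v *\<^sub>R (positive_laplace N (w * of_real (v powr (- 1 / \<alpha>))) / of_real v))
       holomorphic_on ({w. 0 < Re w} \<inter> ball 0 R)"
    proof (cases "v \<ge> 1")
      case True
      then show ?thesis
        unfolding scaleR_conv_of_real
        by (intro holomorphic_intros holomorphic_on_compose_gen[OF _ holomorphic_on_positive_laplace, unfolded comp_def]) auto
    qed auto
  qed auto
  then have "log_kappa \<alpha> N holomorphic_on (\<Union>R\<in>UNIV. {w. Re w > 0} \<inter> ball 0 R)"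
    by (intro holomorphic_on_UN_open o)
  moreover have "(\<Union>R\<in>UNIV. {w::complex. Re w > 0} \<inter> ball 0 R) = {w. Re w > 0}"
    by (auto intro: gt_ex)
  ultimately show "log_kappa \<alpha> N holomorphic_on {w. Re w > 0}" by simp
qed

section \<open>Growth in the right half-plane\<close>

text \<open>Replacing v by \<open>c powr (- \<alpha>)\<close> v absorbs the factor \<open>c\<close>
  into \<open>v powr (- 1 / \<alpha>)\<close>, while dv / v is invariant. Scaling the argument thus
  only moves the lower limit of integration from 1 to \<open>c powr (- \<alpha>)\<close>, and
  increments of \<open>log_kappa\<close> along rays become integrals over a bounded
  interval.\<close>

lemma log_kappa_scale:
  assumes "Re w \<ge> 0" "c \<ge> 1"
  shows "set_integrable lborel {c powr (- \<alpha>)..<1} (\<lambda>v. positive_laplace N (w * of_real (v powr (- 1 / \<alpha>))) / of_real v)"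
    and "log_kappa \<alpha> N (of_real c * w) = log_kappa \<alpha> N w +
      (LBINT v:{c powr (- \<alpha>)..<1}. positive_laplace N (w * of_real (v powr (- 1 / \<alpha>))) / of_real v)"
proof -
  define k where "k = c powr (- \<alpha>)"
  have k: "0 < k" "k \<le> 1"
    using assms alpha by (simp_all add: k_def powr_minus inverse_le_1_iff ge_one_powr_ge_zero)
  have "k powr (- 1 / \<alpha>) = c powr (- \<alpha> * (- 1 / \<alpha>))"
    by (simp only: k_def powr_powr)
  also have "- \<alpha> * (- 1 / \<alpha>) = 1" using alpha by simp
  finally have k': "k powr (- 1 / \<alpha>) = c" using assms by simp
  define f where "f v = positive_laplace N (w * of_real (v powr (- 1 / \<alpha>))) / of_real v" for v
  \<comment> \<open>The Jacobian \<open>k\<close> cancels the \<open>k\<close> in 1 / (k v), so the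
    affine change of variable reproduces the integrand for the scaled argument exactly.\<close>
  have eq: "k *\<^sub>R (indicator {k..} (0 + k * v) *\<^sub>R f (0 + k * v))
      = indicator {1..} v *\<^sub>R (positive_laplace N (of_real c * w * of_real (v powr (- 1 / \<alpha>))) / of_real v)" for v
  proof (cases "v \<ge> 1")
    case True
    then have "(k * v) powr (- 1 / \<alpha>) = c * v powr (- 1 / \<alpha>)" using k k' by (simp add: powr_mult)
    then show ?thesis using True k by (simp add: f_def scaleR_conv_of_real mult_ac)
  qed (use k in \<open>auto simp: indicator_def\<close>)
  have cw: "Re (of_real c * w) \<ge> 0" using assms by simp
  have i1: "set_integrable lborel {k..} f"
  proof -
    have "integrable lborel (\<lambda>v. k *\<^sub>R (indicator {k..} (0 + k * v) *\<^sub>R f (0 + k * v)))"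
      unfolding eq by (rule integrable_log_kappa[OF cw])
    then have "integrable lborel (\<lambda>v. (1 / k) *\<^sub>R k *\<^sub>R (indicator {k..} (0 + k * v) *\<^sub>R f (0 + k * v)))"
      by (rule integrable_scaleR_right)
    then have "integrable lborel (\<lambda>v. indicator {k..} (0 + k * v) *\<^sub>R f (0 + k * v))"
      using k(1) by simp
    then show ?thesis
      using lborel_integrable_real_affine_iff[of k "\<lambda>v. indicator {k..} v *\<^sub>R f v" 0] k(1)
      by (simp add: set_integrable_def)
  qed
  show i2: "set_integrable lborel {c powr (- \<alpha>)..<1} (\<lambda>v. positive_laplace N (w * of_real (v powr (- 1 / \<alpha>))) / of_real v)"
    by (rule set_integrable_subset[OF i1[unfolded f_def k_def]]) auto
  have i3: "set_integrable lborel {1..} f"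
    using k by (intro set_integrable_subset[OF i1]) auto
  have "log_kappa \<alpha> N (of_real c * w) = (LBINT v. k *\<^sub>R (indicator {k..} (0 + k * v) *\<^sub>R f (0 + k * v)))"
    unfolding log_kappa_alt eq ..
  also have "\<dots> = (LBINT v:{k..}. f v)"
    using lborel_integral_real_affine[of k "\<lambda>v. indicator {k..} v *\<^sub>R f v" 0] k(1)
    unfolding integral_scaleR_right set_lebesgue_integral_def by simp
  also have "{k..} = {k..<1} \<union> {1..}" using k by auto
  also have "(LBINT v:{k..<1} \<union> {1..}. f v) = (LBINT v:{k..<1}. f v) + (LBINT v:{1..}. f v)"
    using i2 i3 by (intro set_integral_Un) (auto simp: f_def[abs_def] k_def)
  finally show "log_kappa \<alpha> N (of_real c * w) = log_kappa \<alpha> N w +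
      (LBINT v:{c powr (- \<alpha>)..<1}. positive_laplace N (w * of_real (v powr (- 1 / \<alpha>))) / of_real v)"
    by (simp add: f_def k_def log_kappa_def)
qed

lemma LBINT_inverse_powr:
  assumes "c \<ge> 1"
  shows "set_integrable lborel {c powr (- \<alpha>)..<1} (\<lambda>v::real. B / v)"
    and "(LBINT v:{c powr (- \<alpha>)..<1}. B / v) = B * \<alpha> * ln c"
proof -
  define k where "k = c powr (- \<alpha>)"
  have k: "0 < k" "k \<le> 1" "ln k = - \<alpha> * ln c"
    using assms alpha by (simp_all add: k_def ln_powr powr_minus[of c] inverse_le_1_iff ge_one_powr_ge_zero ln_inverse)
  have b: "has_bochner_integral lborel (\<lambda>v. B / v * indicator {k..1} v) (B * ln 1 - B * ln k)"
    using k by (intro has_bochner_integral_FTC_Icc_real)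
      (auto intro!: derivative_eq_intros continuous_intros)
  have ae: "AE v in lborel. indicator {k..1} v *\<^sub>R (B / v) = indicator {k..<1} v *\<^sub>R (B / v)"
    using AE_lborel_singleton[of 1] by eventually_elim (auto simp: indicator_def)
  have "integrable lborel (\<lambda>v. indicator {k..1} v *\<^sub>R (B / v))"
    using b by (simp add: has_bochner_integral_iff mult.commute)
  then show "set_integrable lborel {c powr (- \<alpha>)..<1} (\<lambda>v::real. B / v)"
    unfolding set_integrable_def k_def[symmetric]
    by (subst integrable_cong_AE[OF _ _ ae, symmetric]) auto
  have "(LBINT v:{k..<1}. B / v) = (LBINT v:{k..1}. B / v)"
    unfolding set_lebesgue_integral_def
    by (subst integral_cong_AE[OF _ _ ae]) auto
  also have "\<dots> = B * \<alpha> * ln c"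
    using b k(3) by (simp add: has_bochner_integral_iff mult.commute set_lebesgue_integral_def)
  finally show "(LBINT v:{c powr (- \<alpha>)..<1}. B / v) = B * \<alpha> * ln c" by (simp add: k_def)
qed

text \<open>The interval has length \<alpha> ln c for the measure dv / v. A bound \<open>B\<close>
  along the ray thus limits the growth of kappa to the order \<open>c powr (B * \<alpha>)\<close>:
  exponents are read off from bounds for \<open>positive_laplace\<close>.\<close>

lemma norm_log_kappa_scale_le:
  assumes "Re w \<ge> 0" "c \<ge> 1"
    and "\<And>v. 0 < v \<Longrightarrow> norm (positive_laplace N (w * of_real (v powr (- 1 / \<alpha>)))) \<le> B"
  shows "norm (log_kappa \<alpha> N (of_real c * w) - log_kappa \<alpha> N w) \<le> B * \<alpha> * ln c"
proof -
  let ?f = "\<lambda>v. positive_laplace N (w * of_real (v powr (- 1 / \<alpha>))) / of_real v"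
  have p: "0 < c powr (- \<alpha>)" using assms by simp
  have "norm (log_kappa \<alpha> N (of_real c * w) - log_kappa \<alpha> N w) = norm (LBINT v:{c powr (- \<alpha>)..<1}. ?f v)"
    by (simp add: log_kappa_scale(2)[OF assms(1,2)])
  also have "\<dots> \<le> (LBINT v:{c powr (- \<alpha>)..<1}. norm (?f v))"
    by (rule set_integral_norm_bound[OF log_kappa_scale(1)[OF assms(1,2)]])
  also have "\<dots> \<le> (LBINT v:{c powr (- \<alpha>)..<1}. B / v)"
  proof (rule set_integral_mono)
    show "set_integrable lborel {c powr (- \<alpha>)..<1} (\<lambda>v. norm (?f v))"
      using log_kappa_scale(1)[OF assms(1,2)] by (rule set_integrable_norm)
    fix v assume "v \<in> {c powr (- \<alpha>)..<1}"
    then have "v > 0" using order_less_le_trans[OF p] by simp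
    then show "norm (?f v) \<le> B / v" using assms(3)[of v] by (simp add: norm_divide divide_right_mono)
  qed (rule LBINT_inverse_powr(1)[OF assms(2)])
  finally show ?thesis by (simp add: LBINT_inverse_powr(2)[OF assms(2)])
qed


section \<open>Conjugation symmetry and growth on the positive axis\<close>

lemma positive_laplace_cnj: "positive_laplace N (cnj w) = cnj (positive_laplace N w)"
proof -
  have "positive_laplace N (cnj w) = (\<integral>x. cnj (indicator {0<..} x *\<^sub>R (1 - exp (- (w * of_real x)))) \<partial>N)"
    unfolding positive_laplace_alt by (intro Bochner_Integration.integral_cong refl) (simp add: exp_cnj)
  then show ?thesis by (simp only: Bochner_Integration.integral_cnj positive_laplace_alt)
qed

lemma log_kappa_cnj: "log_kappa \<alpha> N (cnj w) = cnj (log_kappa \<alpha> N w)"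
proof -
  have "log_kappa \<alpha> N (cnj w) = (LBINT v. cnj (indicator {1..} v *\<^sub>R (positive_laplace N (w * of_real (v powr (- 1 / \<alpha>))) / of_real v)))"
    unfolding log_kappa_alt by (intro Bochner_Integration.integral_cong refl) (simp add: positive_laplace_cnj[symmetric])
  then show ?thesis by (simp only: Bochner_Integration.integral_cnj log_kappa_alt)
qed

lemma Re_positive_laplace_of_real:
  assumes "x \<ge> 0"
  shows "Re (positive_laplace N (of_real x)) = (\<integral>y. indicator {0<..} y * (1 - exp (- (x * y))) \<partial>N)"
proof -
  have "Re (positive_laplace N (of_real x)) = (\<integral>y. Re (indicator {0<..} y *\<^sub>R (1 - exp (- (of_real x * of_real y)))) \<partial>N)"
    unfolding positive_laplace_alt using assms by (intro integral_Re[symmetric] integrable_positive_laplace) simp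
  also have "\<dots> = (\<integral>y. indicator {0<..} y * (1 - exp (- (x * y))) \<partial>N)"
    by (simp add: Re_exp)
  finally show ?thesis .
qed

lemma integrable_positive_laplace_of_real:
  assumes "x \<ge> 0"
  shows "integrable N (\<lambda>y. indicator {0<..} y * (1 - exp (- (x * y))))"
  using assms by (intro integrable_const_bound[where B = 1]) (auto simp: indicator_def)

lemma positive_laplace_of_real:
  "positive_laplace N (of_real x) = of_real (Re (positive_laplace N (of_real x)))"
  using positive_laplace_cnj[of "of_real x"] by (simp add: complex_eq_iff)

lemma log_kappa_of_real:
  "log_kappa \<alpha> N (of_real x) = of_real (Re (log_kappa \<alpha> N (of_real x)))"
  using log_kappa_cnj[of "of_real x"] by (simp add: complex_eq_iff)

lemma Re_positive_laplace_mono: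
  assumes "0 \<le> x" "x \<le> y"
  shows "Re (positive_laplace N (of_real x)) \<le> Re (positive_laplace N (of_real y))"
proof -
  have "(\<integral>z. indicator {0<..} z * (1 - exp (- (x * z))) \<partial>N) \<le> (\<integral>z. indicator {0<..} z * (1 - exp (- (y * z))) \<partial>N)"
    using assms by (intro integral_mono integrable_positive_laplace_of_real) (auto simp: indicator_def mult_right_mono)
  then show ?thesis using assms by (simp add: Re_positive_laplace_of_real)
qed

lemma Re_positive_laplace_nonneg: "0 \<le> x \<Longrightarrow> 0 \<le> Re (positive_laplace N (of_real x))"
  using Re_positive_laplace_mono[of 0 x] by (simp add: positive_laplace_alt)

text \<open>On the positive axis the integrand lies between 0 and the indicator of the half-line.
  Having a probability here, in place of the crude bound 2, gives kappa the growth exponent \<alpha>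
  P(Y > 0).\<close>

lemma norm_positive_laplace_of_real_le:
  assumes "0 \<le> x"
  shows "norm (positive_laplace N (of_real x)) \<le> prob {0<..}"
proof -
  have "norm (positive_laplace N (of_real x)) = Re (positive_laplace N (of_real x))"
    using positive_laplace_of_real[of x] Re_positive_laplace_nonneg[OF assms] by (metis abs_of_nonneg norm_of_real)
  also have "\<dots> \<le> (\<integral>y. indicator {0<..} y \<partial>N)"
    unfolding Re_positive_laplace_of_real[OF assms]
    by (intro integral_mono integrable_positive_laplace_of_real assms integrable_const_bound[where B = 1]) (auto simp: indicator_def)
  finally show ?thesis by simp
qed

text \<open>\<open>1 - exp (- y)\<close> is strictly positive for y > 0, so a vanishing mean would
  make the half-line a null set. Multiplied by \<alpha>, this value is the decay exponent obtained
  for 1 / kappa.\<close>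

lemma Re_positive_laplace_1_pos:
  assumes "prob {0<..} > 0"
  shows "Re (positive_laplace N 1) > 0"
proof -
  have "(\<integral>y. indicator {0<..} y * (1 - exp (- (1 * y))) \<partial>N) \<noteq> 0"
  proof
    assume "(\<integral>y. indicator {0<..} y * (1 - exp (- (1 * y))) \<partial>N) = 0"
    then have "AE y in N. indicator {0<..} y * (1 - exp (- (1 * y))) = 0"
      using integrable_positive_laplace_of_real[of 1]
      by (subst (asm) integral_nonneg_eq_0_iff_AE) (auto simp: indicator_def)
    then have "AE y in N. y \<notin> {0<..}" by eventually_elim (auto simp: indicator_def)
    then have "prob {0<..} = 0" by (subst prob_eq_0) auto
    then show False using assms by simp
  qed
  then show ?thesis using Re_positive_laplace_nonneg[of 1] Re_positive_laplace_of_real[of 1] by simp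
qed

lemma Re_log_kappa_of_real_nonneg:
  assumes "x \<ge> 0"
  shows "Re (log_kappa \<alpha> N (of_real x)) \<ge> 0"
proof -
  have "Re (log_kappa \<alpha> N (of_real x))
      = (LBINT v. Re (indicator {1..} v *\<^sub>R (positive_laplace N (of_real x * of_real (v powr (- 1 / \<alpha>))) / of_real v)))"
    unfolding log_kappa_alt using assms by (intro integral_Re[symmetric] integrable_log_kappa) simp
  also have "\<dots> \<ge> 0"
  proof (intro integral_nonneg_AE AE_I2)
    fix v :: real
    have "0 \<le> Re (positive_laplace N (of_real (x * v powr (- 1 / \<alpha>))))" using assms by (intro Re_positive_laplace_nonneg) simp
    then show "0 \<le> Re (indicator {1..} v *\<^sub>R (positive_laplace N (of_real x * of_real (v powr (- 1 / \<alpha>))) / of_real v))"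
      by (auto simp: indicator_def)
  qed
  finally show ?thesis .
qed

lemma Re_log_kappa_of_real_le:
  assumes "x \<ge> 1"
  shows "Re (log_kappa \<alpha> N (of_real x)) \<le> Re (log_kappa \<alpha> N 1) + prob {0<..} * \<alpha> * ln x"
proof -
  have "norm (log_kappa \<alpha> N (of_real x * 1) - log_kappa \<alpha> N 1) \<le> prob {0<..} * \<alpha> * ln x"
  proof (rule norm_log_kappa_scale_le)
    fix v :: real assume "v > 0"
    show "norm (positive_laplace N (1 * of_real (v powr (- 1 / \<alpha>)))) \<le> prob {0<..}"
      using norm_positive_laplace_of_real_le[of "v powr (- 1 / \<alpha>)"] by simp
  qed (use assms in auto)
  from order_trans[OF complex_Re_le_cmod this] show ?thesis by simp
qed

text \<open>For v < 1 the point \<open>v powr (- 1 / \<alpha>)\<close> is at least 1, and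
  monotonicity keeps \<open>positive_laplace\<close> above its value at 1. The exponent is not
  optimal, but positive as soon as Y charges the positive half-line.\<close>

lemma Re_log_kappa_of_real_ge:
  assumes "x \<ge> 1"
  shows "Re (log_kappa \<alpha> N (of_real x)) \<ge> Re (positive_laplace N 1) * \<alpha> * ln x"
proof -
  let ?I = "{x powr (- \<alpha>)..<1}"
  let ?f = "\<lambda>v. positive_laplace N (1 * of_real (v powr (- 1 / \<alpha>))) / of_real v"
  have i: "set_integrable lborel ?I ?f" and eq: "log_kappa \<alpha> N (of_real x * 1) = log_kappa \<alpha> N 1 + (LBINT v:?I. ?f v)"
    using log_kappa_scale[of 1 x] assms by simp_all
  have "Re (positive_laplace N 1) * \<alpha> * ln x = (LBINT v:?I. Re (positive_laplace N 1) / v)"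
    by (rule LBINT_inverse_powr(2)[OF assms, symmetric])
  also have "\<dots> \<le> (LBINT v:?I. Re (?f v))"
  proof (rule set_integral_mono)
    show "set_integrable lborel ?I (\<lambda>v. Re (?f v))"
      using integrable_Re[OF i[unfolded set_integrable_def]] by (simp add: set_integrable_def)
    fix v assume v: "v \<in> ?I"
    have "0 < x powr (- \<alpha>)" using assms by simp
    then have v: "0 < v" "v < 1" using v order_less_le_trans[of 0 "x powr (- \<alpha>)" v] by auto
    then have "1 \<le> v powr (- 1 / \<alpha>)"
      using alpha by (simp add: powr_minus one_le_inverse_iff powr_le1)
    then have "Re (positive_laplace N (of_real 1)) \<le> Re (positive_laplace N (of_real (v powr (- 1 / \<alpha>))))"
      by (intro Re_positive_laplace_mono) auto
    then show "Re (positive_laplace N 1) / v \<le> Re (?f v)" using v by (simp add: divide_right_mono)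
  qed (rule LBINT_inverse_powr(1)[OF assms])
  also have "\<dots> = Re (LBINT v:?I. ?f v)"
    using integral_Re[OF i[unfolded set_integrable_def]] by (simp add: set_lebesgue_integral_def)
  also have "\<dots> \<le> Re (log_kappa \<alpha> N (of_real x))"
    using eq Re_log_kappa_of_real_nonneg[of 1] by simp
  finally show ?thesis .
qed

text \<open>
  The increments of \<open>log_kappa\<close> along rays are controlled by scaling, and for a holomorphic function
  the radial derivative is the full derivative.
\<close>

lemma norm_deriv_log_kappa_le:
  assumes "Re w > 0"
  shows "norm (deriv (log_kappa \<alpha> N) w) \<le> 2 * \<alpha> / norm w"
proof -
  have w: "w \<noteq> 0" "norm w > 0" using assms by auto
  have "(log_kappa \<alpha> N has_field_derivative deriv (log_kappa \<alpha> N) w) (at w)"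
    using assms by (intro holomorphic_derivI[OF holomorphic_on_log_kappa open_halfspace_Re_gt]) simp
  then have *: "((\<lambda>z. (log_kappa \<alpha> N z - log_kappa \<alpha> N w) / (z - w)) \<longlongrightarrow> deriv (log_kappa \<alpha> N) w) (at w)"
    by (simp add: has_field_derivative_iff)
  \<comment> \<open>The points approach \<open>w\<close> along its ray, scaled by c = 1 + 1/(n+1).
    The scaling bound 2 \<alpha> ln c together with ln c \<le> c - 1 limits each difference quotient
    by 2 \<alpha> / |w|; the 2 is the uniform bound for \<open>positive_laplace\<close>.\<close>
  define s where "s n = of_real (1 + 1 / real (Suc n)) * w" for n
  have sw: "s n - w = of_real (1 / real (Suc n)) * w" for n by (simp add: s_def algebra_simps)
  have nsw: "norm (s n - w) = norm w / real (Suc n)" for n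
    unfolding sw norm_mult norm_of_real by simp
  have "(\<lambda>n. 1 + 1 / real (Suc n)) \<longlonglongrightarrow> 1" by real_asymp
  then have "s \<longlonglongrightarrow> of_real 1 * w" unfolding s_def[abs_def] by (intro tendsto_intros)
  moreover have "s n \<noteq> w" for n using nsw[of n] w by auto
  ultimately have "(\<lambda>n. (log_kappa \<alpha> N (s n) - log_kappa \<alpha> N w) / (s n - w)) \<longlonglongrightarrow> deriv (log_kappa \<alpha> N) w"
    using * unfolding tendsto_at_iff_sequentially comp_def by auto
  then show ?thesis
  proof (rule tendsto_upperbound[OF tendsto_norm])
    have "norm ((log_kappa \<alpha> N (s n) - log_kappa \<alpha> N w) / (s n - w)) \<le> 2 * \<alpha> / norm w" for n
    proof -
      define c where "c = 1 + 1 / real (Suc n)"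
      have "norm (log_kappa \<alpha> N (of_real c * w) - log_kappa \<alpha> N w) \<le> 2 * \<alpha> * ln c"
        using assms by (intro norm_log_kappa_scale_le norm_positive_laplace_le_2) (auto simp: c_def)
      also have "ln c \<le> 1 / real (Suc n)"
        unfolding c_def by (rule ln_add_one_self_le_self) simp
      finally have "norm (log_kappa \<alpha> N (s n) - log_kappa \<alpha> N w) \<le> 2 * \<alpha> * (1 / real (Suc n))"
        using alpha by (simp add: s_def c_def)
      also have "\<dots> = 2 * \<alpha> / norm w * norm (s n - w)" using w by (simp add: nsw)
      finally have "norm (log_kappa \<alpha> N (s n) - log_kappa \<alpha> N w) \<le> 2 * \<alpha> / norm w * norm (s n - w)" .
      moreover have "norm (s n - w) > 0" using nsw[of n] w by simp
      ultimately show ?thesis unfolding norm_divide by (simp only: pos_divide_le_eq)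
    qed
    then show "\<forall>\<^sub>F n in sequentially. norm ((log_kappa \<alpha> N (s n) - log_kappa \<alpha> N w) / (s n - w)) \<le> 2 * \<alpha> / norm w"
      by simp
  qed simp
qed

text \<open>Integrating the derivative bound 2 \<alpha> / |z| along the chord from |w| to w gives a
  constant free of |w|: in the upper quadrant the chord keeps distance |w| / sqrt 2 from 0 and has
  length at most |w| sqrt 2. Conjugation covers the lower quadrant and continuity the imaginary
  axis.\<close>

lemma norm_log_kappa_arc_le:
  assumes "Re w \<ge> 0"
  shows "norm (log_kappa \<alpha> N w - log_kappa \<alpha> N (of_real (norm w))) \<le> 4 * \<alpha>"
proof -
  have upper: "norm (log_kappa \<alpha> N w - log_kappa \<alpha> N (of_real (norm w))) \<le> 4 * \<alpha>" if w: "Re w > 0" "Im w \<ge> 0" for w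
  proof -
    define r where "r = norm w"
    have r: "r > 0" using w by (auto simp: r_def)
    \<comment> \<open>The second set is the half-plane Re z + Im z \<ge> r, bounded by the line
      through r and \<i> r. The intersection is convex, contains both end points and keeps |z| above
      r / sqrt 2.\<close>
    define T where "T = {z. Re z > 0} \<inter> {z. Complex 1 1 \<bullet> z \<ge> r}"
    have inT: "Complex 1 1 \<bullet> z = Re z + Im z" for z by (simp add: inner_complex_def)
    have dist: "(norm (w - of_real r))\<^sup>2 \<le> 2 * r\<^sup>2"
    proof -
      have "(norm (w - of_real r))\<^sup>2 = (norm w)\<^sup>2 + r\<^sup>2 - 2 * r * Re w"
        unfolding cmod_power2 by (simp add: power2_eq_square algebra_simps)
      also have "\<dots> \<le> 2 * r\<^sup>2" using r w by (simp add: r_def)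
      finally show ?thesis .
    qed
    then have dist': "norm (w - of_real r) \<le> sqrt 2 * r"
      using r by - (rule power2_le_imp_le, auto simp: power_mult_distrib)
    have "norm (log_kappa \<alpha> N w - log_kappa \<alpha> N (of_real r)) \<le> (2 * \<alpha> * sqrt 2 / r) * norm (w - of_real r)"
    proof (rule field_differentiable_bound[where S = T and f' = "deriv (log_kappa \<alpha> N)"])
      show "convex T" unfolding T_def by (intro convex_Int convex_halfspace_Re_gt convex_halfspace_ge)
      show "w \<in> T" using w cmod_le[of w] by (simp add: T_def inT r_def)
      show "of_real r \<in> T" using r by (simp add: T_def inT)
      fix z assume z: "z \<in> T"
      then show "(log_kappa \<alpha> N has_field_derivative deriv (log_kappa \<alpha> N) z) (at z within T)"
        by (intro has_field_derivative_at_within[OF holomorphic_derivI[OF holomorphic_on_log_kappa open_halfspace_Re_gt]])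
          (simp add: T_def)
      have "0 \<le> (Re z - Im z)\<^sup>2" by simp
      then have "(Re z + Im z)\<^sup>2 \<le> 2 * (norm z)\<^sup>2"
        unfolding cmod_power2 by (simp add: power2_eq_square algebra_simps)
      moreover have "r\<^sup>2 \<le> (Re z + Im z)\<^sup>2" using z r by (intro power_mono) (auto simp: T_def inT)
      ultimately have "r\<^sup>2 \<le> (sqrt 2 * norm z)\<^sup>2" by (simp add: power_mult_distrib)
      then have le: "r \<le> sqrt 2 * norm z" by (rule power2_le_imp_le) simp
      have zp: "norm z > 0" using z by (auto simp: T_def)
      have "norm (deriv (log_kappa \<alpha> N) z) \<le> 2 * \<alpha> / norm z"
        using z by (intro norm_deriv_log_kappa_le) (simp add: T_def)
      also have "\<dots> \<le> 2 * \<alpha> * sqrt 2 / r"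
        using mult_left_mono[OF le, of "2 * \<alpha>"] alpha r zp by (simp add: field_simps)
      finally show "norm (deriv (log_kappa \<alpha> N) z) \<le> 2 * \<alpha> * sqrt 2 / r" .
    qed
    also have "(2 * \<alpha> * sqrt 2 / r) * norm (w - of_real r) \<le> (2 * \<alpha> * sqrt 2 / r) * (sqrt 2 * r)"
      using alpha r dist' by (intro mult_left_mono) auto
    also have "\<dots> = 4 * \<alpha>" using r by simp
    finally show ?thesis by (simp add: r_def)
  qed
  have half: "norm (log_kappa \<alpha> N w - log_kappa \<alpha> N (of_real (norm w))) \<le> 4 * \<alpha>" if w: "Re w > 0" for w
  proof (cases "Im w \<ge> 0")
    case False
    then have "norm (log_kappa \<alpha> N (cnj w) - log_kappa \<alpha> N (of_real (norm (cnj w)))) \<le> 4 * \<alpha>"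
      using w by (intro upper) auto
    moreover have "log_kappa \<alpha> N (cnj w) - log_kappa \<alpha> N (of_real (norm (cnj w))) = cnj (log_kappa \<alpha> N w - log_kappa \<alpha> N (of_real (norm w)))"
      using log_kappa_cnj[of w] log_kappa_cnj[of "of_real (norm w)"] by simp
    ultimately show ?thesis by (simp only: complex_mod_cnj)
  qed (use upper w in auto)
  define s where "s n = w + of_real (1 / real (Suc n))" for n
  have "(\<lambda>n. 1 / real (Suc n)) \<longlonglongrightarrow> 0" by real_asymp
  then have "s \<longlonglongrightarrow> w + of_real 0" unfolding s_def[abs_def] by (intro tendsto_intros)
  then have s: "s \<longlonglongrightarrow> w" by simp
  have sp: "Re (s n) > 0" for n using assms by (simp add: s_def add_nonneg_pos)
  have lim: "(\<lambda>n. log_kappa \<alpha> N (t n)) \<longlonglongrightarrow> log_kappa \<alpha> N v" if "t \<longlonglongrightarrow> v" "\<And>n. Re (t n) \<ge> 0" "Re v \<ge> 0" for t v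
    using continuous_on_log_kappa that unfolding continuous_on_sequentially comp_def by auto
  have "(\<lambda>n. log_kappa \<alpha> N (s n) - log_kappa \<alpha> N (of_real (norm (s n)))) \<longlonglongrightarrow> log_kappa \<alpha> N w - log_kappa \<alpha> N (of_real (norm w))"
    using assms sp by (intro tendsto_diff lim tendsto_of_real tendsto_norm s) (auto intro: less_imp_le)
  then show ?thesis
    using half[OF sp] by (intro tendsto_upperbound[OF tendsto_norm]) auto
qed


section \<open>Wiener--Hopf factorization and the positivity coefficient\<close>

abbreviation dual :: "real measure" where "dual \<equiv> distr N borel uminus"

lemma dual_law: "stable_exp_law dual \<alpha> (- \<gamma>)"
proof -
  interpret D: real_distribution dual by (rule real_distribution_distr) simp
  show ?thesis
  proof
    fix z
    have "char dual z = char N (- z)"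
      unfolding char_def by (subst integral_distr) auto
    also have "\<dots> = 1 / (1 + stable_symbol \<alpha> (- \<gamma>) z)"
      by (simp add: char_N stable_symbol_def sgn_minus)
    finally show "char dual z = 1 / (1 + stable_symbol \<alpha> (- \<gamma>) z)" .
  qed (use alpha gamma in auto)
qed

text \<open>At these two points both integrands are \<open>1 - iexp (z * x)\<close>, one on x > 0
  and the other, after reflection, on x < 0. This function vanishes at x = 0, so together they cover
  the whole line.\<close>

lemma positive_laplace_add_positive_laplace_dual:
  "positive_laplace N (- (\<i> * of_real z)) + positive_laplace dual (\<i> * of_real z) = 1 - char N z"
proof -
  interpret D: stable_exp_law dual \<alpha> "- \<gamma>" by (rule dual_law)
  have 1: "positive_laplace dual (\<i> * of_real z)
      = (\<integral>x. indicator {0<..} (- x) *\<^sub>R (1 - exp (- (\<i> * of_real z * of_real (- x)))) \<partial>N)"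
    unfolding D.positive_laplace_alt by (rule integral_distr) auto
  have 2: "integrable N (\<lambda>x. indicator {0<..} (- x) *\<^sub>R (1 - exp (- (\<i> * of_real z * of_real (- x)))))"
    by (rule integrable_distr[OF _ D.integrable_positive_laplace]) auto
  have "positive_laplace N (- (\<i> * of_real z)) + positive_laplace dual (\<i> * of_real z)
      = (\<integral>x. indicator {0<..} x *\<^sub>R (1 - exp (- (- (\<i> * of_real z) * of_real x)))
          + indicator {0<..} (- x) *\<^sub>R (1 - exp (- (\<i> * of_real z * of_real (- x)))) \<partial>N)"
    unfolding 1 positive_laplace_alt using 2 by (intro Bochner_Integration.integral_add[symmetric] integrable_positive_laplace) auto
  also have "\<dots> = (\<integral>x. 1 - iexp (z * x) \<partial>N)"
    by (intro Bochner_Integration.integral_cong refl) (auto simp: indicator_def mult_ac)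
  also have "\<dots> = 1 - char N z"
    unfolding char_def using integrable_iexp[of "\<lambda>x. z * x"] prob_space by simp
  finally show ?thesis .
qed

text \<open>Homogeneity turns the symbol at \<open>z * v powr (- 1 / \<alpha>)\<close> into s / v.
  The combined integrand is then s / (v (v + s)), with primitive - Ln(1 + s / v); Re s \<ge> 0 keeps
  the argument of \<open>Ln\<close> away from the branch cut on the whole range.\<close>

lemma log_kappa_add_log_kappa_dual:
  assumes z: "z > 0"
  shows "log_kappa \<alpha> N (- (\<i> * of_real z)) + log_kappa \<alpha> dual (\<i> * of_real z) = Ln (1 + stable_symbol \<alpha> \<gamma> z)"
proof -
  interpret D: stable_exp_law dual \<alpha> "- \<gamma>" by (rule dual_law)
  define s where "s = stable_symbol \<alpha> \<gamma> z"
  define f where "f v = s / (of_real v * (of_real v + s))" for v :: real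
  have Re_s: "Re s \<ge> 0" unfolding s_def by (rule Re_symbol_nonneg)
  have symbol: "stable_symbol \<alpha> \<gamma> (z * v powr (- 1 / \<alpha>)) = s / of_real v" if "v > 0" for v
  proof -
    have "\<bar>z * v powr (- 1 / \<alpha>)\<bar> powr \<alpha> = z powr \<alpha> * v powr (- 1)"
      using z that alpha by (simp add: powr_mult powr_powr)
    then show ?thesis
      using z that by (simp add: stable_symbol_def s_def powr_minus sgn_mult divide_inverse)
  qed
  have vs: "of_real v + s \<noteq> 0" "(of_real v :: complex) \<noteq> 0" if "v > 0" for v
  proof -
    have "Re (of_real v + s) > 0" using that Re_s by simp
    then show "of_real v + s \<noteq> 0" by (metis less_irrefl zero_complex.sel(1))
  qed (use that in auto)
  have f: "indicator {1..} v *\<^sub>R (positive_laplace N (- (\<i> * of_real z) * of_real (v powr (- 1 / \<alpha>))) / of_real v)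
      + indicator {1..} v *\<^sub>R (positive_laplace dual (\<i> * of_real z * of_real (v powr (- 1 / \<alpha>))) / of_real v)
      = indicator {1..} v *\<^sub>R f v" for v :: real
  proof (cases "v \<ge> 1")
    case True
    have "positive_laplace N (- (\<i> * of_real z) * of_real (v powr (- 1 / \<alpha>))) + positive_laplace dual (\<i> * of_real z * of_real (v powr (- 1 / \<alpha>)))
        = 1 - 1 / (1 + s / of_real v)"
      using positive_laplace_add_positive_laplace_dual[of "z * v powr (- 1 / \<alpha>)"] symbol[of v] True by (simp add: char_N mult_ac)
    also have "1 + s / of_real v = (of_real v + s) / of_real v"
      using vs[of v] True by (simp add: field_simps)
    also have "1 - 1 / ((of_real v + s) / of_real v) = s / (of_real v + s)"
      using vs[of v] True by (simp add: field_simps)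
    finally show ?thesis
      using True by (simp add: f_def add_divide_distrib[symmetric] mult.commute)
  qed auto
  have i: "integrable lborel (\<lambda>v. indicator {1..} v *\<^sub>R f v)"
    unfolding f[symmetric] by (intro Bochner_Integration.integrable_add integrable_log_kappa D.integrable_log_kappa) auto
  have "log_kappa \<alpha> N (- (\<i> * of_real z)) + log_kappa \<alpha> dual (\<i> * of_real z) = (LBINT v. indicator {1..} v *\<^sub>R f v)"
    unfolding log_kappa_alt D.log_kappa_alt f[symmetric]
    by (intro Bochner_Integration.integral_add[symmetric] integrable_log_kappa D.integrable_log_kappa) auto
  also have "\<dots> = (LBINT v:{1<..}. f v)"
    unfolding set_lebesgue_integral_def f_def
    using AE_lborel_singleton[of 1] by (intro integral_cong_AE) (auto simp: indicator_def elim!: eventually_mono)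
  also have "\<dots> = 0 - (- Ln (1 + s))"
  proof (rule LBINT_FTC_Ioi[where F = "\<lambda>v. - Ln (1 + s / of_real v)"])
    show "set_integrable lborel {1<..} f"
      by (rule set_integrable_subset[of lborel "{1..}"]) (use i in \<open>auto simp: set_integrable_def\<close>)
    fix v :: real assume v: "v > 1"
    have "Re (s / of_real v) \<ge> 0" using v Re_s by simp
    then have "Re (1 + s / of_real v) > 0" by simp
    then have nn: "1 + s / of_real v \<notin> \<real>\<^sub>\<le>\<^sub>0" by (auto simp: complex_nonpos_Reals_iff)
    have "((\<lambda>u. - Ln (1 + s / u)) has_field_derivative f v) (at (of_real v))"
      using nn vs[of v] v
      by (auto intro!: derivative_eq_intros simp: f_def field_simps power2_eq_square)
    then show "((\<lambda>v. - Ln (1 + s / of_real v)) has_vector_derivative f v) (at v)"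
      by (rule has_vector_derivative_real_field)
    show "isCont f v" unfolding f_def[abs_def] using vs[of v] v by (intro continuous_intros) auto
  next
    have "Re (1 + s) > 0" using Re_s by simp
    then have nn: "1 + s \<notin> \<real>\<^sub>\<le>\<^sub>0" by (auto simp: complex_nonpos_Reals_iff)
    have "((\<lambda>v. - Ln (1 + s / of_real v)) \<longlongrightarrow> - Ln (1 + s / of_real 1)) (at_right 1)"
      using nn by (intro tendsto_intros) auto
    then show "((\<lambda>v. - Ln (1 + s / of_real v)) \<longlongrightarrow> - Ln (1 + s)) (at_right 1)" by simp
    have "((\<lambda>v. of_real (inverse v)) \<longlongrightarrow> (of_real 0 :: complex)) at_top"
      by (intro tendsto_of_real tendsto_inverse_0_at_top filterlim_ident)
    then have "((\<lambda>v. - Ln (1 + s * of_real (inverse v))) \<longlongrightarrow> - Ln (1 + s * of_real 0)) at_top"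
      by (intro tendsto_minus tendsto_Ln tendsto_add tendsto_mult tendsto_const) auto
    then show "((\<lambda>v. - Ln (1 + s / of_real v)) \<longlongrightarrow> 0) at_top"
      by (simp add: divide_inverse)
  qed
  finally show ?thesis by (simp add: s_def)
qed

section \<open>The atom at zero and the probability of the positive half-line\<close>

lemma norm_char_le: "x \<noteq> 0 \<Longrightarrow> norm (char N x) \<le> 1 / \<bar>x\<bar> powr \<alpha>"
proof -
  assume x: "x \<noteq> 0"
  let ?s = "stable_symbol \<alpha> \<gamma> x"
  have "(norm ?s)\<^sup>2 \<le> (norm (1 + ?s))\<^sup>2"
    unfolding cmod_power2 using Re_symbol_nonneg[of x] by (simp add: power2_eq_square algebra_simps)
  then have "norm ?s \<le> norm (1 + ?s)" by (rule power2_le_imp_le) simp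
  then show ?thesis
    using x by (simp add: char_N norm_divide norm_symbol frac_le)
qed

text \<open>
  The average of \<open>Re (char N)\<close> against the exponential density is the expectation of a Cauchy kernel,
  which dominates the atom at \<open>0\<close>.
\<close>

lemma prob_0: "prob {0} = 0"
proof -
  have "(\<lambda>n. LBINT z:{0<..}. exp (- z) * Re (char N (real (Suc n) * z))) \<longlonglongrightarrow> (LBINT z::real:{0<..}. 0 :: real)"
    unfolding set_lebesgue_integral_def
  proof (rule integral_dominated_convergence)
    show "integrable lborel (\<lambda>z::real. indicator {0<..} z *\<^sub>R exp (- (z * 1)))"
      using integrable_I0i_exp_mscale[of 1] by (simp add: set_integrable_def)
    show "AE z in lborel. norm (indicator {0<..} z *\<^sub>R (exp (- z) * Re (char N (real (Suc n) * z))))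
        \<le> indicator {0<..} z *\<^sub>R exp (- (z * 1))" for n
      by (auto simp: abs_mult indicator_def intro!: mult_left_le order_trans[OF abs_Re_le_cmod cmod_char_le_1])
    show "AE z in lborel. (\<lambda>n. indicator {0<..} z *\<^sub>R (exp (- z) * Re (char N (real (Suc n) * z)))) \<longlonglongrightarrow> indicator {0<..} z *\<^sub>R (0::real)"
    proof (intro AE_I2)
      fix z :: real
      show "(\<lambda>n. indicator {0<..} z *\<^sub>R (exp (- z) * Re (char N (real (Suc n) * z)))) \<longlonglongrightarrow> indicator {0<..} z *\<^sub>R (0::real)"
      proof (cases "z > 0")
        case True
        have "(\<lambda>n. char N (real (Suc n) * z)) \<longlonglongrightarrow> 0"
        proof (rule Lim_null_comparison)
          show "\<forall>\<^sub>F n in sequentially. norm (char N (real (Suc n) * z)) \<le> 1 / (real (Suc n) * z) powr \<alpha>"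
            using norm_char_le[of "real (Suc n) * z" for n] True by (intro always_eventually allI) (simp add: abs_mult)
          show "(\<lambda>n. 1 / (real (Suc n) * z) powr \<alpha>) \<longlonglongrightarrow> 0"
            using True alpha by real_asymp
        qed
        then have "(\<lambda>n. indicator {0<..} z *\<^sub>R (exp (- z) * Re (char N (real (Suc n) * z)))) \<longlonglongrightarrow> indicator {0<..} z *\<^sub>R (exp (- z) * Re 0)"
          by (intro tendsto_intros)
        then show ?thesis by simp
      qed auto
    qed
  qed auto
  then have "(\<lambda>n. expectation (\<lambda>x. 1 / (1 + (real (Suc n) * x)\<^sup>2))) \<longlonglongrightarrow> 0"
    by (simp add: expectation_cauchy_kernel del: of_nat_Suc)
  moreover have "prob {0} \<le> expectation (\<lambda>x. 1 / (1 + (real (Suc n) * x)\<^sup>2))" for n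
  proof -
    have le1: "1 \<le> a \<Longrightarrow> norm (1 / a) \<le> 1" for a :: real by simp
    have "expectation (indicator {0}) \<le> expectation (\<lambda>x. 1 / (1 + (real (Suc n) * x)\<^sup>2))"
    proof (rule integral_mono)
      show "integrable N (\<lambda>x. 1 / (1 + (real (Suc n) * x)\<^sup>2))"
      proof (rule integrable_const_bound[where B = 1])
        have "norm (1 / (1 + (real (Suc n) * x)\<^sup>2)) \<le> 1" for x
          using le1[of "1 + (real (Suc n) * x)\<^sup>2"] by simp
        then show "AE x in N. norm (1 / (1 + (real (Suc n) * x)\<^sup>2)) \<le> 1" by blast
      qed simp
      show "indicator {0} x \<le> 1 / (1 + (real (Suc n) * x)\<^sup>2)" for x
        by (cases "x = 0") (auto simp: add_nonneg_nonneg)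
    qed (auto intro!: integrable_const_bound[where B = 1] simp: indicator_def)
    then show ?thesis by simp
  qed
  ultimately have "prob {0} \<le> 0" by (intro LIMSEQ_le_const) auto
  then show ?thesis by (simp add: antisym)
qed

text \<open>
  Zolotarev's formula: the Dirichlet integral recovers \<open>sgn\<close> from \<open>Im (char N z) / z\<close>,
  whose primitive is explicit because \<open>char N\<close> is a rational function of \<open>z powr \<alpha>\<close> on \<open>z > 0\<close>.
\<close>

lemma expectation_sgn: "expectation sgn = 2 * \<gamma> / (pi * \<alpha>)"
proof -
  \<comment> \<open>\<open>G T x\<close> is the integral of sin(z x) / z over z from 0 to T, with
    limit sgn x times pi / 2 as T grows; \<open>H\<close> is a primitive of
    \<open>Im (char N z) / z\<close> on z > 0.\<close>
  define G where "G T x = sgn x * Si (T * \<bar>x\<bar>)" for T x :: real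
  define H where "H z = - (1 / \<alpha>) * Im (Ln (1 + of_real (z powr \<alpha>) * cis (- \<gamma>)))" for z
  have [measurable]: "G T \<in> borel_measurable borel" for T unfolding G_def by measurable
  obtain B where B: "\<And>T. \<bar>Si T\<bar> \<le> B" using bounded_Si by blast
  have GB: "\<bar>G T x\<bar> \<le> B" for T x
    using B[of 0] B[of "T * \<bar>x\<bar>"] by (auto simp: G_def abs_mult sgn_if)
  have intG: "integrable N (G T)" for T
    using GB by (intro integrable_const_bound[where B = B]) auto
  have sc: "Re (1 + of_real (z powr \<alpha>) * cis (- \<gamma>)) > 0" for z
  proof -
    have "cos \<gamma> > 0" using gamma by (intro cos_gt_zero_pi) auto
    then show ?thesis by (simp add: add_pos_nonneg)
  qed
  \<comment> \<open>Away from 0 the kernel sin(z x) / z is bounded by 1 / a, which justifies Fubini.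
    The limits in a and b are taken afterwards, with \<open>Si\<close> bounded on the left and the
    closed form on the right.\<close>
  have key: "expectation (G b) - expectation (G a) = H b - H a" if ab: "0 < a" "a \<le> b" for a b
  proof -
    interpret P: pair_sigma_finite lborel N by unfold_locales
    define f where "f = (\<lambda>(z::real, x::real). indicator {a..b} z * (sin (z * x) / z))"
    have [measurable]: "f \<in> borel_measurable (lborel \<Otimes>\<^sub>M N)"
      unfolding f_def by measurable
    have int: "integrable (lborel \<Otimes>\<^sub>M N) f"
    proof (rule Bochner_Integration.integrable_bound)
      show "integrable (lborel \<Otimes>\<^sub>M N) (\<lambda>(z::real, x::real). indicator {a..b} z * (1 / a) :: real)"
      proof (rule P.Fubini_integrable)
        show "(\<lambda>(z::real, x::real). indicat_real {a..b} z * (1 / a)) \<in> borel_measurable (lborel \<Otimes>\<^sub>M N)"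
          by measurable
        have "integrable lborel (\<lambda>z. indicat_real {a..b} z / \<bar>a\<bar>)"
          by (intro integrable_divide_zero integrable_real_indicator) (auto simp: emeasure_lborel_Icc_eq)
        then show "integrable lborel (\<lambda>z. \<integral>x. norm (case (z, x) of (z, x) \<Rightarrow> indicat_real {a..b} z * (1 / a)) \<partial>N)"
          using prob_space by simp
      qed simp_all
      show "AE x in lborel \<Otimes>\<^sub>M N. norm (f x) \<le> norm (case x of (z, x) \<Rightarrow> indicat_real {a..b} z * (1 / a))"
        using ab by (intro AE_I2) (auto simp: f_def indicator_def abs_mult split: prod.split intro!: frac_le)
    qed measurable
    have "expectation (G b) - expectation (G a) = expectation (\<lambda>x. G b x - G a x)"
      using intG by simp
    also have "\<dots> = (\<integral>x. (LBINT z. f (z, x)) \<partial>N)"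
    proof (intro Bochner_Integration.integral_cong refl)
      fix x :: real
      have "(\<integral>z. sin (z * x) / z * indicator {a..b} z \<partial>lborel) = G b x - G a x"
        unfolding G_def
      proof (rule integral_FTC_Icc_real)
        fix z assume z: "a \<le> z" "z \<le> b"
        show "((\<lambda>T. sgn x * Si (T * \<bar>x\<bar>)) has_real_derivative sin (z * x) / z) (at z)"
        proof -
          have "((\<lambda>T. T * \<bar>x\<bar>) has_real_derivative \<bar>x\<bar>) (at z)" by (auto intro!: derivative_eq_intros)
          from DERIV_cmult[OF DERIV_chain2[OF DERIV_Si this], of "sgn x"]
          have "((\<lambda>T. sgn x * Si (T * \<bar>x\<bar>)) has_real_derivative sgn x * (sinc (z * \<bar>x\<bar>) * \<bar>x\<bar>)) (at z)" .
          moreover have "sgn x * (sinc (z * \<bar>x\<bar>) * \<bar>x\<bar>) = sin (z * x) / z"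
            using z ab by (auto simp: sgn_if abs_if)
          ultimately show ?thesis by simp
        qed
        show "isCont (\<lambda>z. sin (z * x) / z) z" using z ab by (intro continuous_intros) auto
      qed (use ab in auto)
      then show "G b x - G a x = (LBINT z. f (z, x))" by (simp add: f_def mult.commute)
    qed
    also have "\<dots> = (LBINT z. \<integral>x. f (z, x) \<partial>N)"
      using P.Fubini_integral[of "\<lambda>z x. f (z, x)"] int by simp
    also have "\<dots> = (\<integral>z. Im (char N z) / z * indicator {a..b} z \<partial>lborel)"
    proof (intro Bochner_Integration.integral_cong refl)
      fix z :: real
      have "Im (char N z) = expectation (\<lambda>x. Im (iexp (z * x)))"
        unfolding char_def by (rule integral_Im[symmetric], rule integrable_iexp) auto
      also have "\<dots> = expectation (\<lambda>x. sin (z * x))"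
        by (simp only: cis_conv_exp[symmetric] cis.sel mult_ac)
      finally show "(\<integral>x. f (z, x) \<partial>N) = Im (char N z) / z * indicator {a..b} z"
        by (simp add: f_def)
    qed
    also have "\<dots> = H b - H a"
    proof (rule integral_FTC_Icc_real)
      fix z assume z: "a \<le> z" "z \<le> b"
      define s where "s = of_real (z powr \<alpha>) * cis (- \<gamma>)"
      have char: "char N z = 1 / (1 + s)"
        using z ab by (simp add: char_N stable_symbol_def s_def)
      have nz: "1 + s \<noteq> 0" using sc[of z] unfolding s_def by (metis less_irrefl zero_complex.sel(1))
      have nn: "1 + s \<notin> \<real>\<^sub>\<le>\<^sub>0" using sc[of z] by (auto simp: complex_nonpos_Reals_iff s_def)
      have "((\<lambda>z. z powr \<alpha>) has_vector_derivative \<alpha> * z powr (\<alpha> - 1)) (at z)"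
        using z ab by (auto intro!: derivative_eq_intros simp: has_real_derivative_iff_has_vector_derivative[symmetric])
      from has_vector_derivative_add[OF has_vector_derivative_const
          has_vector_derivative_mult_left[OF bounded_linear.has_vector_derivative[OF bounded_linear_of_real this]]]
      have "((\<lambda>z. 1 + of_real (z powr \<alpha>) * cis (- \<gamma>)) has_vector_derivative
          of_real (\<alpha> * z powr (\<alpha> - 1)) * cis (- \<gamma>)) (at z)"
        by simp
      moreover have "(Ln has_field_derivative inverse (1 + s)) (at (1 + s))"
        using nn by (rule has_field_derivative_Ln)
      ultimately have "((Ln \<circ> (\<lambda>z. 1 + of_real (z powr \<alpha>) * cis (- \<gamma>))) has_vector_derivative
          of_real (\<alpha> * z powr (\<alpha> - 1)) * cis (- \<gamma>) * inverse (1 + s)) (at z)"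
        unfolding s_def by (intro field_vector_diff_chain_at) 
      then have "((\<lambda>z. Im (Ln (1 + of_real (z powr \<alpha>) * cis (- \<gamma>)))) has_vector_derivative
          Im (of_real (\<alpha> * z powr (\<alpha> - 1)) * cis (- \<gamma>) * inverse (1 + s))) (at z)"
        unfolding comp_def by (rule bounded_linear.has_vector_derivative[OF bounded_linear_Im])
      then have "((\<lambda>z. Im (Ln (1 + of_real (z powr \<alpha>) * cis (- \<gamma>)))) has_real_derivative
          Im (of_real (\<alpha> * z powr (\<alpha> - 1)) * cis (- \<gamma>) * inverse (1 + s))) (at z)"
        by (simp add: has_real_derivative_iff_has_vector_derivative)
      then have "(H has_real_derivative - (1 / \<alpha>) *
          Im (of_real (\<alpha> * z powr (\<alpha> - 1)) * cis (- \<gamma>) * inverse (1 + s))) (at z)"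
        unfolding H_def by (rule DERIV_cmult)
      moreover have "- (1 / \<alpha>) * Im (of_real (\<alpha> * z powr (\<alpha> - 1)) * cis (- \<gamma>) * inverse (1 + s)) = Im (char N z) / z"
      proof -
        have "of_real (\<alpha> * z powr (\<alpha> - 1)) * cis (- \<gamma>) * inverse (1 + s) = of_real (\<alpha> / z) * (s / (1 + s))"
          using z ab by (simp add: s_def powr_diff divide_inverse mult_ac)
        also have "s / (1 + s) = 1 - char N z" using nz by (simp add: char field_simps)
        finally show ?thesis using alpha
          by (simp only: times_complex.sel Re_complex_of_real Im_complex_of_real minus_complex.sel one_complex.sel) simp
      qed
      ultimately show "(H has_real_derivative Im (char N z) / z) (at z)" by simp
      show "isCont (\<lambda>z. Im (char N z) / z) z"
        using z ab by (intro continuous_intros isCont_o2[OF isCont_char]) auto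
    qed (use ab in auto)
    finally show ?thesis .
  qed
  have ae: "AE x in N. x \<noteq> 0"
    using prob_0 prob_eq_0[of "{0}"] by simp
  have "(\<lambda>n. expectation (\<lambda>x. G (real (Suc n)) x - G (1 / real (Suc n)) x)) \<longlonglongrightarrow> expectation (\<lambda>x. sgn x * (pi / 2) - sgn x * Si 0)"
  proof (rule integral_dominated_convergence[where w = "\<lambda>_. B + B"])
    show "AE x in N. norm (G (real (Suc n)) x - G (1 / real (Suc n)) x) \<le> B + B" for n
      using GB[of "real (Suc n)"] GB[of "1 / real (Suc n)"]
      by (intro AE_I2) (smt (verit) real_norm_def)
    show "AE x in N. (\<lambda>n. G (real (Suc n)) x - G (1 / real (Suc n)) x) \<longlonglongrightarrow> sgn x * (pi / 2) - sgn x * Si 0"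
      using ae
    proof eventually_elim
      fix x :: real assume x: "x \<noteq> 0"
      have "filterlim (\<lambda>n. real (Suc n) * \<bar>x\<bar>) at_top sequentially" using x by real_asymp
      moreover have "(\<lambda>n. 1 / real (Suc n) * \<bar>x\<bar>) \<longlonglongrightarrow> 0" by real_asymp
      ultimately show "(\<lambda>n. G (real (Suc n)) x - G (1 / real (Suc n)) x) \<longlonglongrightarrow> sgn x * (pi / 2) - sgn x * Si 0"
        unfolding G_def by (intro tendsto_intros filterlim_compose[OF Si_at_top] isCont_tendsto_compose[OF isCont_Si])
    qed
  qed auto
  then have 1: "(\<lambda>n. H (real (Suc n)) - H (1 / real (Suc n))) \<longlonglongrightarrow> expectation sgn * (pi / 2)"
  proof -
    have "expectation (\<lambda>x. G (real (Suc n)) x - G (1 / real (Suc n)) x) = H (real (Suc n)) - H (1 / real (Suc n))" for n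
      using key[of "1 / real (Suc n)" "real (Suc n)"] intG by (simp add: field_simps)
    moreover have "Si 0 = 0" using Si_neg[of 0] by simp
    ultimately show ?thesis
      using \<open>(\<lambda>n. expectation (\<lambda>x. G (real (Suc n)) x - G (1 / real (Suc n)) x)) \<longlonglongrightarrow> _\<close> by simp
  qed
  have "(\<lambda>n. H (real (Suc n)) - H (1 / real (Suc n))) \<longlonglongrightarrow> - (1 / \<alpha>) * (- \<gamma>) - (- (1 / \<alpha>) * Im (Ln (1 + of_real 0 * cis (- \<gamma>))))"
  proof (rule tendsto_diff)
    have "(\<lambda>n. (1 / real (Suc n)) powr \<alpha>) \<longlonglongrightarrow> 0" using alpha by real_asymp
    then show "(\<lambda>n. H (1 / real (Suc n))) \<longlonglongrightarrow> - (1 / \<alpha>) * Im (Ln (1 + of_real 0 * cis (- \<gamma>)))"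
      unfolding H_def by (intro tendsto_intros) auto
    \<comment> \<open>As x grows, the argument of \<open>Ln\<close> in \<open>H\<close> diverges.
      Dividing it by the positive number \<open>x powr \<alpha>\<close> leaves the imaginary part of
      \<open>Ln\<close> unchanged and produces the finite limit
      \<open>cis (- \<gamma>)\<close>.\<close>
    have H': "H x = - (1 / \<alpha>) * Im (Ln (of_real (x powr (- \<alpha>)) + cis (- \<gamma>)))" if "x > 0" for x
    proof -
      have "1 + of_real (x powr \<alpha>) * cis (- \<gamma>) = of_real (x powr \<alpha>) * (of_real (x powr (- \<alpha>)) + cis (- \<gamma>))"
        using that by (simp add: distrib_left powr_minus flip: of_real_mult)
      moreover have "of_real (x powr (- \<alpha>)) + cis (- \<gamma>) \<noteq> 0"
        using calculation sc[of x] by (metis less_irrefl mult_zero_right zero_complex.sel(1))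
      ultimately show ?thesis using that by (simp add: H_def Ln_times_of_real)
    qed
    have "cos \<gamma> > 0" using gamma by (intro cos_gt_zero_pi) auto
    then have c: "cis (- \<gamma>) \<notin> \<real>\<^sub>\<le>\<^sub>0" by (auto simp: complex_nonpos_Reals_iff)
    have "(\<lambda>n. real (Suc n) powr (- \<alpha>)) \<longlonglongrightarrow> 0" using alpha by real_asymp
    then have "(\<lambda>n. - (1 / \<alpha>) * Im (Ln (of_real (real (Suc n) powr (- \<alpha>)) + cis (- \<gamma>)))) \<longlonglongrightarrow> - (1 / \<alpha>) * Im (Ln (of_real 0 + cis (- \<gamma>)))"
      using c by (intro tendsto_intros) auto
    moreover have "Im (Ln (of_real 0 + cis (- \<gamma>))) = - \<gamma>"
      using gamma pi_gt_zero by (simp add: cis_conv_exp Ln_exp)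
    ultimately show "(\<lambda>n. H (real (Suc n))) \<longlonglongrightarrow> - (1 / \<alpha>) * (- \<gamma>)"
      using H'[of "real (Suc n)" for n] by simp
  qed
  with 1 have "expectation sgn * (pi / 2) = \<gamma> / \<alpha>"
    by (auto dest: LIMSEQ_unique)
  then show ?thesis using alpha by (simp add: field_simps)
qed

text \<open>E sgn Y = P(Y > 0) - P(Y < 0), and 0 is not an atom. The open half-line governs the
  growth exponents, the closed one the positivity coefficient.\<close>

lemma prob_pos: "prob {0<..} = 1 / 2 + \<gamma> / (pi * \<alpha>)"
  and prob_nonneg: "prob {0..} = 1 / 2 + \<gamma> / (pi * \<alpha>)"
proof -
  have "expectation sgn = expectation (\<lambda>x. indicator {0<..} x - indicator {..<0} x)"
    by (intro Bochner_Integration.integral_cong refl) (auto simp: sgn_if indicator_def)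
  also have "\<dots> = prob {0<..} - prob {..<0}"
    by (subst Bochner_Integration.integral_diff) (auto intro!: integrable_const_bound[where B = 1] simp: indicator_def)
  finally have 1: "prob {0<..} - prob {..<0} = 2 * \<gamma> / (pi * \<alpha>)" by (simp add: expectation_sgn)
  have 2: "prob {0..} = prob {0} + prob {0<..}"
    by (subst finite_measure_Union[symmetric]) (auto intro: arg_cong[where f = prob])
  have "prob (space N - {..<0}) = 1 - prob {..<0}" by (rule prob_compl) simp
  moreover have "space N - {..<0} = {0..}" by auto
  ultimately have 3: "prob {0..} = 1 - prob {..<0}" by simp
  show "prob {0<..} = 1 / 2 + \<gamma> / (pi * \<alpha>)" "prob {0..} = 1 / 2 + \<gamma> / (pi * \<alpha>)"
    using 1 2 3 prob_0 by (simp_all add: field_simps)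
qed


section \<open>Analytic continuation and contour integration\<close>

text \<open>The angle by which (\<i>z)^\<alpha>, of argument pi \<alpha> / 2, has to be turned back
  to reach the argument - \<gamma> of the symbol at z > 0.\<close>

definition phi :: real where "phi = pi * \<alpha> / 2 + \<gamma>"

lemma phi_prob: "phi = pi * \<alpha> * prob {0<..}"
  using alpha by (simp add: phi_def prob_pos field_simps)

lemma ii_powr:
  assumes "z > 0"
  shows "(\<i> * of_real z) powr of_real \<alpha> = of_real (z powr \<alpha>) * cis (pi * \<alpha> / 2)"
proof -
  have "Ln (\<i> * of_real z) = of_real (ln z) + \<i> * of_real (pi / 2)"
    using assms Ln_times_of_real[of z \<i>] by (simp add: mult.commute Ln_of_real)
  then have "(\<i> * of_real z) powr of_real \<alpha> = exp (of_real (\<alpha> * ln z) + \<i> * of_real (pi * \<alpha> / 2))"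
    using assms by (simp add: powr_def algebra_simps)
  also have "\<dots> = of_real (exp (\<alpha> * ln z)) * cis (pi * \<alpha> / 2)"
    by (simp only: exp_add cis_conv_exp exp_of_real)
  finally show ?thesis using assms by (simp add: powr_def)
qed

text \<open>The symbol is a function of a real frequency z. In the variable w = \<i>z its values for
  z > 0, increased by 1, are the restriction of this function, holomorphic in the right half-plane,
  to the positive imaginary axis.\<close>

definition symbol_ext :: "complex \<Rightarrow> complex" where "symbol_ext w = 1 + w powr of_real \<alpha> * cis (- phi)"

lemma symbol_ext_ii: "z > 0 \<Longrightarrow> symbol_ext (\<i> * of_real z) = 1 + stable_symbol \<alpha> \<gamma> z"
  by (simp add: symbol_ext_def ii_powr stable_symbol_def mult.assoc cis_mult phi_def)

abbreviation quadrant :: "complex set" where "quadrant \<equiv> {w. Re w \<ge> 0} \<inter> {w. Im w \<ge> 0}"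

text \<open>On the quadrant the argument of \<open>w powr of_real \<alpha> * cis (- phi)\<close>
  runs from - phi to pi \<alpha> / 2 - phi = - \<gamma>. With phi < pi and |\<gamma>| < pi / 2 it
  stays strictly between - pi and pi, so the value - 1 is not attained.\<close>

lemma symbol_ext_nonzero:
  assumes "phi < pi" and w: "w \<in> quadrant"
  shows "symbol_ext w \<noteq> 0"
proof
  assume "symbol_ext w = 0"
  have w0: "w \<noteq> 0" using \<open>symbol_ext w = 0\<close> by (auto simp: symbol_ext_def)
  define \<psi> where "\<psi> = Im (Ln w)"
  have psi: "0 \<le> \<psi>" "\<psi> \<le> pi / 2"
    using w w0 Im_Ln_pos_le[of w] Re_Ln_pos_le[of w] by (auto simp: \<psi>_def)
  define t where "t = \<alpha> * \<psi> - phi"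
  have "of_real \<alpha> * Ln w = of_real (\<alpha> * Re (Ln w)) + \<i> * of_real (\<alpha> * \<psi>)"
    by (simp add: \<psi>_def complex_eq_iff)
  then have "w powr of_real \<alpha> = exp (of_real (\<alpha> * Re (Ln w)) + \<i> * of_real (\<alpha> * \<psi>))"
    using w0 by (simp add: powr_def)
  also have "\<dots> = of_real (exp (\<alpha> * Re (Ln w))) * cis (\<alpha> * \<psi>)"
    by (simp only: exp_add cis_conv_exp exp_of_real)
  finally have eq: "of_real (exp (\<alpha> * Re (Ln w))) * cis t = - 1"
    using \<open>symbol_ext w = 0\<close> by (simp add: symbol_ext_def t_def mult.assoc cis_mult eq_neg_iff_add_eq_0 add.commute)
  then have "exp (\<alpha> * Re (Ln w)) * sin t = 0" "exp (\<alpha> * Re (Ln w)) * cos t = - 1"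
    by (simp_all add: complex_eq_iff)
  moreover have "\<bar>t\<bar> < pi"
  proof -
    have "\<alpha> * \<psi> \<le> \<alpha> * (pi / 2)" using alpha psi by (intro mult_left_mono) auto
    then have "t \<le> - \<gamma>" by (simp add: t_def phi_def algebra_simps)
    moreover have "t \<ge> - phi" using alpha psi by (simp add: t_def)
    ultimately show ?thesis using assms gamma by auto
  qed
  ultimately have "t = 0" by (simp add: sin_zero_pi_iff)
  with \<open>exp (\<alpha> * Re (Ln w)) * cos t = - 1\<close> have "exp (\<alpha> * Re (Ln w)) = - 1" by simp
  then show False using exp_gt_zero[of "\<alpha> * Re (Ln w)"] by linarith
qed

lemma continuous_on_symbol_ext: "continuous_on quadrant symbol_ext"
  unfolding symbol_ext_def using alpha by (intro continuous_intros) auto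

lemma holomorphic_on_symbol_ext: "symbol_ext holomorphic_on {w. Re w > 0}"
  unfolding symbol_ext_def by (intro holomorphic_intros) (auto simp: complex_nonpos_Reals_iff)

lemma norm_powr_alpha: "norm (w powr of_real \<alpha>) = norm w powr \<alpha>" for w :: complex
  by (auto simp: powr_def norm_exp_eq_Re Re_Ln)

definition recip_kappa :: "complex \<Rightarrow> complex" where "recip_kappa w = exp (- log_kappa \<alpha> N w)"

definition recip_kappa_ext :: "complex \<Rightarrow> complex" where "recip_kappa_ext w = exp (log_kappa \<alpha> dual w) / symbol_ext w"

text \<open>
  \<open>w \<mapsto> recip_kappa_ext (-w)\<close> continues \<open>recip_kappa\<close> from the negative imaginary axis to the
  lower left quadrant.
\<close>

lemma recip_kappa_eq_recip_kappa_ext: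
  assumes "z > 0"
  shows "recip_kappa (- (\<i> * of_real z)) = recip_kappa_ext (\<i> * of_real z)"
proof -
  have "exp (log_kappa \<alpha> N (- (\<i> * of_real z))) * exp (log_kappa \<alpha> dual (\<i> * of_real z)) = symbol_ext (\<i> * of_real z)"
    using norm_1_symbol[of z] by (simp add: symbol_ext_ii assms exp_add[symmetric] log_kappa_add_log_kappa_dual)
  then show ?thesis using norm_1_symbol[of z]
    by (simp add: recip_kappa_def recip_kappa_ext_def exp_minus symbol_ext_ii[OF assms] field_simps)
qed

lemma norm_recip_kappa_le:
  assumes "Re w \<ge> 0" "norm w \<ge> 1"
  shows "norm (recip_kappa w) \<le> exp (4 * \<alpha>) * norm w powr (- (Re (positive_laplace N 1) * \<alpha>))"
proof -
  have "- Re (log_kappa \<alpha> N w) + Re (log_kappa \<alpha> N (of_real (norm w))) \<le> 4 * \<alpha>"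
    using order_trans[OF abs_Re_le_cmod norm_log_kappa_arc_le[OF assms(1)]] by simp
  then have "- Re (log_kappa \<alpha> N w) \<le> 4 * \<alpha> + - (Re (positive_laplace N 1) * \<alpha>) * ln (norm w)"
    using Re_log_kappa_of_real_ge[OF assms(2)] by simp
  then have "exp (- Re (log_kappa \<alpha> N w)) \<le> exp (4 * \<alpha> + - (Re (positive_laplace N 1) * \<alpha>) * ln (norm w))"
    by simp
  then show ?thesis
    using assms(2) by (auto simp: recip_kappa_def norm_exp_eq_Re powr_def mult_exp_exp)
qed

text \<open>The dual kappa grows at most with exponent \<alpha> P(Y < 0) = \<alpha> - phi / pi and
  the denominator with exponent \<alpha>, which leaves decay of order phi / pi. The condition
  \<open>norm w powr \<alpha> \<ge> 2\<close> ensures that the 1 in \<open>symbol_ext\<close>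
  absorbs at most half of the main term.\<close>

lemma norm_recip_kappa_ext_le:
  assumes "w \<in> quadrant" "norm w \<ge> 1" "norm w powr \<alpha> \<ge> 2"
  shows "norm (recip_kappa_ext w) \<le> 2 * exp (4 * \<alpha> + Re (log_kappa \<alpha> dual 1)) * norm w powr (- (phi / pi))"
proof -
  interpret D: stable_exp_law dual \<alpha> "- \<gamma>" by (rule dual_law)
  have w: "Re w \<ge> 0" "norm w > 0" using assms by auto
  have "Re (log_kappa \<alpha> dual w) - Re (log_kappa \<alpha> dual (of_real (norm w))) \<le> 4 * \<alpha>"
    using order_trans[OF complex_Re_le_cmod D.norm_log_kappa_arc_le[OF w(1)]] by simp
  then have "Re (log_kappa \<alpha> dual w) \<le> 4 * \<alpha> + Re (log_kappa \<alpha> dual 1) + D.prob {0<..} * \<alpha> * ln (norm w)"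
    using D.Re_log_kappa_of_real_le[OF assms(2)] by simp
  also have "D.prob {0<..} * \<alpha> = \<alpha> - phi / pi"
    using alpha D.prob_pos by (simp add: phi_def field_simps)
  finally have "exp (Re (log_kappa \<alpha> dual w)) \<le> exp (4 * \<alpha> + Re (log_kappa \<alpha> dual 1) + (\<alpha> - phi / pi) * ln (norm w))"
    by simp
  also have "\<dots> = exp (4 * \<alpha> + Re (log_kappa \<alpha> dual 1)) * (norm w powr \<alpha> * norm w powr (- (phi / pi)))"
    using w(2) by (auto simp: exp_add powr_def left_diff_distrib exp_diff exp_minus divide_inverse)
  finally have 1: "norm (exp (log_kappa \<alpha> dual w)) \<le> exp (4 * \<alpha> + Re (log_kappa \<alpha> dual 1)) * (norm w powr \<alpha> * norm w powr (- (phi / pi)))"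
    by (simp add: norm_exp_eq_Re)
  have "norm w powr \<alpha> = norm (w powr of_real \<alpha> * cis (- phi))"
    by (simp add: norm_mult norm_powr_alpha)
  also have "\<dots> = norm (symbol_ext w - 1)" by (simp add: symbol_ext_def)
  also have "\<dots> \<le> norm (symbol_ext w) + 1" using norm_triangle_ineq4[of "symbol_ext w" 1] by simp
  finally have 2: "norm w powr \<alpha> / 2 \<le> norm (symbol_ext w)" using assms(3) by simp
  have "norm (recip_kappa_ext w) \<le> exp (4 * \<alpha> + Re (log_kappa \<alpha> dual 1)) * (norm w powr \<alpha> * norm w powr (- (phi / pi))) / (norm w powr \<alpha> / 2)"
    unfolding recip_kappa_ext_def norm_divide using 1 2 w by (intro frac_le) auto
  also have "\<dots> = 2 * exp (4 * \<alpha> + Re (log_kappa \<alpha> dual 1)) * norm w powr (- (phi / pi))"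
    using w(2) by simp
  finally show ?thesis .
qed

lemma continuous_on_recip_kappa: "continuous_on {w. Re w \<ge> 0} recip_kappa"
  unfolding recip_kappa_def by (intro continuous_intros continuous_on_log_kappa)

lemma holomorphic_on_recip_kappa: "recip_kappa holomorphic_on {w. Re w > 0}"
  unfolding recip_kappa_def by (intro holomorphic_intros holomorphic_on_log_kappa)

lemma continuous_on_recip_kappa_ext: "phi < pi \<Longrightarrow> continuous_on quadrant recip_kappa_ext"
proof -
  assume p: "phi < pi"
  interpret D: stable_exp_law dual \<alpha> "- \<gamma>" by (rule dual_law)
  show ?thesis
    unfolding recip_kappa_ext_def using symbol_ext_nonzero[OF p]
    by (intro continuous_intros continuous_on_symbol_ext continuous_on_subset[OF D.continuous_on_log_kappa]) auto
qed

lemma recip_kappa_ext_differentiable: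
  assumes "phi < pi" "Re w > 0" "Im w > 0"
  shows "recip_kappa_ext field_differentiable at w"
proof -
  interpret D: stable_exp_law dual \<alpha> "- \<gamma>" by (rule dual_law)
  have "log_kappa \<alpha> dual field_differentiable at w" "symbol_ext field_differentiable at w"
    using assms holomorphic_on_imp_differentiable_at[OF D.holomorphic_on_log_kappa open_halfspace_Re_gt]
      holomorphic_on_imp_differentiable_at[OF holomorphic_on_symbol_ext open_halfspace_Re_gt] by auto
  moreover have "(\<lambda>w. exp (log_kappa \<alpha> dual w)) field_differentiable at w"
    using calculation(1) field_differentiable_compose[of "log_kappa \<alpha> dual" w exp]
    by (simp add: comp_def field_differentiable_within_exp)
  ultimately show ?thesis
    unfolding recip_kappa_ext_def using symbol_ext_nonzero[of w] assms by (intro field_differentiable_divide) auto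
qed

text \<open>On the cut the numerator is real, so only 1 / (1 + r cis(- phi)) contributes: its
  imaginary part is r sin phi over |1 + r cis(- phi)|^2, and expanding the modulus gives the
  quadratic denominator.\<close>

lemma Im_recip_kappa_ext_of_real:
  assumes "x > 0"
  shows "Im (recip_kappa_ext (of_real x)) = x powr \<alpha> * exp (Re (log_kappa \<alpha> dual (of_real x))) * sin phi /
    (x powr (2 * \<alpha>) + 2 * x powr \<alpha> * cos phi + 1)"
proof -
  interpret D: stable_exp_law dual \<alpha> "- \<gamma>" by (rule dual_law)
  have expand: "(1 + r * c)\<^sup>2 + (r * s)\<^sup>2 = 1 + 2 * r * c + r\<^sup>2 * (s\<^sup>2 + c\<^sup>2)" for r c s :: real
    by (simp add: power2_eq_square algebra_simps)
  define r where "r = x powr \<alpha>"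
  have symbol_ext: "symbol_ext (of_real x) = 1 + of_real r * cis (- phi)"
    using assms by (simp add: symbol_ext_def r_def powr_of_real)
  have "exp (log_kappa \<alpha> dual (of_real x)) = of_real (exp (Re (log_kappa \<alpha> dual (of_real x))))"
    using D.log_kappa_of_real[of x] assms by (metis exp_of_real less_imp_le)
  then have "recip_kappa_ext (of_real x) = of_real (exp (Re (log_kappa \<alpha> dual (of_real x)))) / (1 + of_real r * cis (- phi))"
    by (simp only: recip_kappa_ext_def symbol_ext)
  also have "Im \<dots> = exp (Re (log_kappa \<alpha> dual (of_real x))) * (r * sin phi) / ((1 + r * cos phi)\<^sup>2 + (r * sin phi)\<^sup>2)"
    by (simp add: Im_divide power2_eq_square)
  also have "(1 + r * cos phi)\<^sup>2 + (r * sin phi)\<^sup>2 = 1 + 2 * r * cos phi + r\<^sup>2 * ((sin phi)\<^sup>2 + (cos phi)\<^sup>2)"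
    by (rule expand)
  also have "r\<^sup>2 = x powr (2 * \<alpha>)"
    by (simp add: r_def power2_eq_square powr_add[symmetric])
  finally show ?thesis by (simp add: r_def mult_ac add_ac)
qed

end

text \<open>The fourth side is listed as \<open>linepath a1 a4\<close>, against the orientation of
  the rectangle, hence the minus sign: in both applications it is a piece of the imaginary axis to
  be traversed upwards.\<close>

lemma contour_integral_rectpath:
  assumes "continuous_on (path_image (rectpath a1 a3)) f"
  defines "a2 \<equiv> Complex (Re a3) (Im a1)" and "a4 \<equiv> Complex (Re a1) (Im a3)"
  shows "contour_integral (rectpath a1 a3) f = contour_integral (linepath a1 a2) f +
    contour_integral (linepath a2 a3) f + contour_integral (linepath a3 a4) f - contour_integral (linepath a1 a4) f"
    and "f contour_integrable_on linepath a1 a2" "f contour_integrable_on linepath a2 a3"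
    "f contour_integrable_on linepath a3 a4" "f contour_integrable_on linepath a1 a4"
proof -
  have img: "path_image (rectpath a1 a3) = closed_segment a1 a2 \<union> closed_segment a2 a3 \<union>
      closed_segment a3 a4 \<union> closed_segment a4 a1"
    by (simp add: rectpath_def Let_def path_image_join Un_assoc a2_def a4_def)
  have i: "f contour_integrable_on linepath a1 a2" "f contour_integrable_on linepath a2 a3"
    "f contour_integrable_on linepath a3 a4" "f contour_integrable_on linepath a4 a1"
    and c: "continuous_on (closed_segment a1 a4) f"
    using assms(1) unfolding img
    by (auto intro!: contour_integrable_continuous_linepath elim: continuous_on_subset simp: closed_segment_commute)
  then show "f contour_integrable_on linepath a1 a2" "f contour_integrable_on linepath a2 a3"
    "f contour_integrable_on linepath a3 a4" "f contour_integrable_on linepath a1 a4"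
    by (auto intro: contour_integrable_continuous_linepath)
  show "contour_integral (rectpath a1 a3) f = contour_integral (linepath a1 a2) f +
    contour_integral (linepath a2 a3) f + contour_integral (linepath a3 a4) f - contour_integral (linepath a1 a4) f"
    using i contour_integral_reverse_linepath[OF c]
    by (simp add: rectpath_def Let_def a2_def[symmetric] a4_def[symmetric] add_ac)
qed

lemma interior_Re_ge_0: "interior {w. Re w \<ge> 0} = {w. Re w > 0}"
  using interior_halfspace_ge[of "1::complex" 0] by (simp add: inner_complex_def)

lemma interior_Im_ge_0: "interior {w. Im w \<ge> 0} = {w. Im w > 0}"
  using interior_halfspace_ge[of \<i> 0] by (simp add: inner_complex_def)

lemma contour_integral_imaginary_axis:
  assumes "a < b"
  shows "contour_integral (linepath (Complex 0 a) (Complex 0 b)) f = \<i> * integral {a..b} (\<lambda>y. f (\<i> * of_real y))"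
  using assms by (subst contour_integral_linepath_same_Re[where a = a and b = b and c = 0]) (auto simp: Complex_eq)

section \<open>Cauchy integrals in the half-plane and the quadrant\<close>

context stable_exp_law
begin

text \<open>Cauchy's formula on [0, R] x [-R, R]. The left side lies on the boundary of the
  half-plane of holomorphy, so the version with mere continuity up to the boundary of a convex set
  is used. The other sides have total length 4 R and satisfy |w| \<ge> R, whence the bound for
  \<open>E\<close>.\<close>

lemma recip_kappa_contour:
  assumes "0 < \<theta>" "\<theta> < R" "1 \<le> R"
  obtains E where "2 * pi * \<i> * recip_kappa (of_real \<theta>) = E - \<i> * integral {-R..R} (\<lambda>y. recip_kappa (\<i> * of_real y) / (\<i> * of_real y - of_real \<theta>))"
    "norm E \<le> 4 * (exp (4 * \<alpha>) * R powr (- (Re (positive_laplace N 1) * \<alpha>)) / (R - \<theta>)) * R"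
proof -
  define B where "B = exp (4 * \<alpha>) * R powr (- (Re (positive_laplace N 1) * \<alpha>)) / (R - \<theta>)"
  have q: "Re (positive_laplace N 1) * \<alpha> \<ge> 0" using Re_positive_laplace_nonneg[of 1] alpha by simp
  have B0: "B \<ge> 0" using assms by (simp add: B_def)
  let ?f = "\<lambda>w. recip_kappa w / (w - of_real \<theta>)"
  have bound: "norm (?f w) \<le> B" if "Re w \<ge> 0" "norm w \<ge> R" for w
  proof -
    have "norm (recip_kappa w) \<le> exp (4 * \<alpha>) * norm w powr (- (Re (positive_laplace N 1) * \<alpha>))"
      using that assms by (intro norm_recip_kappa_le) auto
    also have "norm w powr (- (Re (positive_laplace N 1) * \<alpha>)) \<le> R powr (- (Re (positive_laplace N 1) * \<alpha>))"
      using that assms q by (intro powr_mono2') auto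
    finally have "norm (recip_kappa w) \<le> exp (4 * \<alpha>) * R powr (- (Re (positive_laplace N 1) * \<alpha>))" by simp
    moreover have "R - \<theta> \<le> norm (w - of_real \<theta>)"
      using norm_triangle_ineq2[of w "of_real \<theta>"] that assms by simp
    ultimately show ?thesis
      unfolding B_def norm_divide using assms by (intro frac_le) auto
  qed
  define a1 where "a1 = Complex 0 (- R)"
  define a3 where "a3 = Complex R R"
  let ?a2 = "Complex (Re a3) (Im a1)" and ?a4 = "Complex (Re a1) (Im a3)"
  let ?\<gamma> = "rectpath a1 a3"
  have ord: "Re a1 \<le> Re a3" "Im a1 \<le> Im a3" "Re a1 < Re a3" "Im a1 < Im a3" using assms by (auto simp: a1_def a3_def)
  have img: "path_image ?\<gamma> = cbox a1 a3 - box a1 a3"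
    using ord by (intro path_image_rectpath_cbox_minus_box) auto
  have box: "of_real \<theta> \<in> box a1 a3" using assms by (simp add: in_box_complex_iff a1_def a3_def)
  have sub: "path_image ?\<gamma> \<subseteq> {w. Re w \<ge> 0} - {of_real \<theta>}"
    using box unfolding img by (auto simp: in_cbox_complex_iff a1_def)
  have int: "interior {w. Re w \<ge> 0} = {w. Re w > 0}"
    by (rule interior_Re_ge_0)
  have "(?f has_contour_integral (2 * pi * \<i> * winding_number ?\<gamma> (of_real \<theta>) * recip_kappa (of_real \<theta>))) ?\<gamma>"
  proof (rule Cauchy_integral_formula_weak[where S = "{w. Re w \<ge> 0}" and k = "{}"])
    show "convex {w. Re w \<ge> 0}" by (rule convex_halfspace_Re_ge)
    show "recip_kappa field_differentiable at x" if "x \<in> interior {w. Re w \<ge> 0} - {}" for x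
      using that int holomorphic_on_imp_differentiable_at[OF holomorphic_on_recip_kappa open_halfspace_Re_gt] by auto
  qed (use assms sub int continuous_on_recip_kappa in auto)
  then have "contour_integral ?\<gamma> ?f = 2 * pi * \<i> * recip_kappa (of_real \<theta>)"
    using winding_number_rectpath[OF box] by (simp add: contour_integral_unique)
  moreover have cont: "continuous_on (path_image ?\<gamma>) ?f"
    using sub by (intro continuous_intros continuous_on_subset[OF continuous_on_recip_kappa]) auto
  note rect = contour_integral_rectpath[OF cont]
  define E where "E = contour_integral (linepath a1 ?a2) ?f + contour_integral (linepath ?a2 a3) ?f + contour_integral (linepath a3 ?a4) ?f"
  ultimately have eq: "2 * pi * \<i> * recip_kappa (of_real \<theta>) = E - contour_integral (linepath a1 ?a4) ?f"
    using rect(1) by (simp add: E_def)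
  have *: "\<bar>Re w\<bar> \<ge> R \<or> \<bar>Im w\<bar> \<ge> R \<Longrightarrow> norm w \<ge> R" for w
    using abs_Re_le_cmod[of w] abs_Im_le_cmod[of w] by auto
  have seg: "w \<in> closed_segment u v \<Longrightarrow> Re u \<ge> 0 \<Longrightarrow> Re v \<ge> 0 \<Longrightarrow> (Re u = R \<and> Re v = R) \<or> (Im u = R \<and> Im v = R) \<or> (Im u = - R \<and> Im v = - R) \<Longrightarrow> norm (?f w) \<le> B" for u v w
  proof -
    assume w: "w \<in> closed_segment u v" and uv: "Re u \<ge> 0" "Re v \<ge> 0"
      and c: "(Re u = R \<and> Re v = R) \<or> (Im u = R \<and> Im v = R) \<or> (Im u = - R \<and> Im v = - R)"
    obtain t where t: "0 \<le> t" "t \<le> 1" "w = (1 - t) *\<^sub>R u + t *\<^sub>R v"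
      using w by (auto simp: closed_segment_def)
    have "Re w \<ge> 0" using t uv by simp
    moreover have "\<bar>Re w\<bar> \<ge> R \<or> \<bar>Im w\<bar> \<ge> R"
      using c assms unfolding t(3) by (auto simp: algebra_simps)
    ultimately show "norm (?f w) \<le> B" by (intro bound *)
  qed
  have "norm E \<le> B * norm (?a2 - a1) + B * norm (a3 - ?a2) + B * norm (?a4 - a3)"
    unfolding E_def
    by (intro norm_triangle_mono contour_integral_bound_linepath rect(2-4) B0 seg) (use assms in \<open>auto simp: a1_def a3_def\<close>)
  moreover have "norm (?a2 - a1) = R" "norm (a3 - ?a2) = 2 * R" "norm (?a4 - a3) = R"
    using assms by (auto simp: a1_def a3_def cmod_def real_sqrt_mult)
  ultimately have "norm E \<le> 4 * B * R" by simp
  moreover have "contour_integral (linepath a1 ?a4) ?f = \<i> * integral {-R..R} (\<lambda>y. ?f (\<i> * of_real y))"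
    using assms contour_integral_imaginary_axis[of "- R" R ?f] by (simp add: a1_def a3_def)
  ultimately show ?thesis using eq by (intro that[of E]) (simp_all add: B_def)
qed

text \<open>Cauchy's theorem on the square [0, R]^2, two sides of which lie on the imaginary axis
  and on the cut. The pole - \<theta> is outside, the integrand is continuous up to both axes
  including the corner 0, and the two far sides of length R form the error. Integrability on the cut
  is recorded for taking imaginary parts.\<close>

lemma recip_kappa_ext_contour:
  assumes "phi < pi" "0 < \<theta>" "1 \<le> R" "2 \<le> R powr \<alpha>"
  obtains E where "\<i> * integral {0..R} (\<lambda>y. recip_kappa_ext (\<i> * of_real y) / (\<i> * of_real y + of_real \<theta>)) =
      integral {0..R} (\<lambda>x. recip_kappa_ext (of_real x) / (of_real x + of_real \<theta>)) + E"
    "norm E \<le> 2 * (2 * exp (4 * \<alpha> + Re (log_kappa \<alpha> dual 1)) * R powr (- (phi / pi)) / R) * R"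
    "(\<lambda>x. recip_kappa_ext (of_real x) / (of_real x + of_real \<theta>)) integrable_on {0..R}"
proof -
  define B where "B = 2 * exp (4 * \<alpha> + Re (log_kappa \<alpha> dual 1)) * R powr (- (phi / pi)) / R"
  have B0: "B \<ge> 0" using assms by (simp add: B_def)
  have p: "phi \<ge> 0" using alpha by (simp add: phi_prob)
  let ?f = "\<lambda>w. recip_kappa_ext w / (w + of_real \<theta>)"
  have bound: "norm (?f w) \<le> B" if "w \<in> quadrant" "norm w \<ge> R" for w
  proof -
    have "norm w powr \<alpha> \<ge> R powr \<alpha>" using that assms alpha by (intro powr_mono2) auto
    then have "norm (recip_kappa_ext w) \<le> 2 * exp (4 * \<alpha> + Re (log_kappa \<alpha> dual 1)) * norm w powr (- (phi / pi))"
      using that assms by (intro norm_recip_kappa_ext_le) auto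
    also have "norm w powr (- (phi / pi)) \<le> R powr (- (phi / pi))"
      using that assms p by (intro powr_mono2') auto
    finally have "norm (recip_kappa_ext w) \<le> 2 * exp (4 * \<alpha> + Re (log_kappa \<alpha> dual 1)) * R powr (- (phi / pi))" by simp
    moreover have "norm w \<le> norm (w + of_real \<theta>)"
    proof (rule power2_le_imp_le)
      show "(norm w)\<^sup>2 \<le> (norm (w + of_real \<theta>))\<^sup>2"
        unfolding cmod_power2 using that assms by (simp add: power2_eq_square algebra_simps)
    qed simp
    ultimately show ?thesis
      unfolding B_def norm_divide using assms that by (intro frac_le) auto
  qed
  define a1 where "a1 = (0 :: complex)"
  define a3 where "a3 = Complex R R"
  let ?a2 = "Complex (Re a3) (Im a1)" and ?a4 = "Complex (Re a1) (Im a3)"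
  let ?\<gamma> = "rectpath a1 a3"
  have sub: "path_image ?\<gamma> \<subseteq> quadrant"
    using path_image_rectpath_subset_cbox[of a1 a3] assms by (auto simp: in_cbox_complex_iff a1_def a3_def)
  have int: "interior quadrant = {w. Re w > 0} \<inter> {w. Im w > 0}"
    by (simp add: interior_Re_ge_0 interior_Im_ge_0)
  have nz: "w + of_real \<theta> \<noteq> 0" if "Re w \<ge> 0" for w
  proof -
    have "Re (w + of_real \<theta>) > 0" using that assms by simp
    then show ?thesis by (metis less_irrefl zero_complex.sel(1))
  qed
  have cont: "continuous_on quadrant ?f"
    using nz by (intro continuous_intros continuous_on_recip_kappa_ext assms) auto
  have "(?f has_contour_integral 0) ?\<gamma>"
  proof (rule Cauchy_theorem_convex[where S = quadrant and K = "{}"])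
    show "convex quadrant" by (intro convex_Int convex_halfspace_Re_ge convex_halfspace_Im_ge)
    show "?f field_differentiable at x" if "x \<in> interior quadrant - {}" for x
    proof -
      have x: "Re x > 0" "Im x > 0" using that unfolding int by auto
      then have "x + of_real \<theta> \<noteq> 0" by (intro nz) simp
      then show ?thesis using x assms(1)
      by (intro field_differentiable_divide recip_kappa_ext_differentiable field_differentiable_add
          field_differentiable_ident field_differentiable_const) auto
    qed
  qed (use sub cont in auto)
  then have "contour_integral ?\<gamma> ?f = 0" by (simp add: contour_integral_unique)
  moreover note rect = contour_integral_rectpath[OF continuous_on_subset[OF cont sub]]
  define E where "E = contour_integral (linepath ?a2 a3) ?f + contour_integral (linepath a3 ?a4) ?f"
  ultimately have eq: "contour_integral (linepath a1 ?a4) ?f = contour_integral (linepath a1 ?a2) ?f + E"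
    using rect(1) by (simp add: E_def add.assoc)
  have *: "\<bar>Re w\<bar> \<ge> R \<or> \<bar>Im w\<bar> \<ge> R \<Longrightarrow> norm w \<ge> R" for w
    using abs_Re_le_cmod[of w] abs_Im_le_cmod[of w] by auto
  have seg: "w \<in> closed_segment u v \<Longrightarrow> u \<in> quadrant \<Longrightarrow> v \<in> quadrant \<Longrightarrow> (Re u = R \<and> Re v = R) \<or> (Im u = R \<and> Im v = R) \<Longrightarrow> norm (?f w) \<le> B" for u v w
  proof -
    assume w: "w \<in> closed_segment u v" and uv: "u \<in> quadrant" "v \<in> quadrant"
      and c: "(Re u = R \<and> Re v = R) \<or> (Im u = R \<and> Im v = R)"
    obtain t where t: "0 \<le> t" "t \<le> 1" "w = (1 - t) *\<^sub>R u + t *\<^sub>R v"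
      using w by (auto simp: closed_segment_def)
    have "w \<in> quadrant" using t uv by simp
    moreover have "\<bar>Re w\<bar> \<ge> R \<or> \<bar>Im w\<bar> \<ge> R"
      using c assms unfolding t(3) by (auto simp: algebra_simps)
    ultimately show "norm (?f w) \<le> B" by (intro bound *)
  qed
  have "norm E \<le> B * norm (a3 - ?a2) + B * norm (?a4 - a3)"
    unfolding E_def
    by (intro norm_triangle_mono contour_integral_bound_linepath rect(3,4) B0 seg) (use assms in \<open>auto simp: a1_def a3_def\<close>)
  moreover have "norm (a3 - ?a2) = R" "norm (?a4 - a3) = R"
    using assms by (auto simp: a1_def a3_def cmod_def real_sqrt_mult)
  ultimately have "norm E \<le> 2 * B * R" by simp
  moreover have "contour_integral (linepath a1 ?a4) ?f = \<i> * integral {0..R} (\<lambda>y. ?f (\<i> * of_real y))"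
    using assms contour_integral_imaginary_axis[of 0 R ?f] by (simp add: a1_def a3_def Complex_eq)
  moreover have a: "a1 \<in> \<real>" "?a2 \<in> \<real>" "Re a1 < Re ?a2" using assms by (auto simp: a1_def a3_def complex_is_Real_iff)
  moreover have "contour_integral (linepath a1 ?a2) ?f = integral {0..R} (\<lambda>x. ?f (of_real x))"
    using contour_integral_linepath_Reals_eq[OF a, of ?f] by (simp add: a1_def a3_def)
  moreover have "(\<lambda>x. ?f (of_real x)) integrable_on {0..R}"
    using contour_integrable_linepath_Reals_iff[OF a, of ?f] rect(2) by (simp add: a1_def a3_def)
  ultimately show ?thesis using eq by (intro that[of E]) (simp_all add: B_def)
qed

lemma recip_kappa_of_real: "recip_kappa (of_real x) = of_real (exp (- Re (log_kappa \<alpha> N (of_real x))))"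
  unfolding recip_kappa_def using log_kappa_of_real[of x] by (metis exp_of_real of_real_minus)

text \<open>The continuation represents \<open>recip_kappa\<close> on the lower half of the axis.
  Because \<open>log_kappa\<close> commutes with conjugation, the upper half contributes the complex
  conjugate, and the two add up to minus twice a real part.\<close>

lemma integral_imaginary_axis_recip_kappa:
  assumes "0 < \<theta>" "0 < R" "phi < pi"
  shows "integral {-R..R} (\<lambda>y. recip_kappa (\<i> * of_real y) / (\<i> * of_real y - of_real \<theta>)) =
    - of_real (2 * Re (integral {0..R} (\<lambda>y. recip_kappa_ext (\<i> * of_real y) / (\<i> * of_real y + of_real \<theta>))))"
proof -
  define g where "g y = recip_kappa (\<i> * of_real y) / (\<i> * of_real y - of_real \<theta>)" for y
  have nz: "\<i> * of_real y - of_real \<theta> \<noteq> 0" "\<i> * of_real y + of_real \<theta> \<noteq> 0" for y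
    using assms by (auto simp: complex_eq_iff)
  have cg: "continuous_on UNIV g"
    unfolding g_def using nz by (intro continuous_intros continuous_on_compose2[OF continuous_on_recip_kappa]) auto
  have gi: "g integrable_on {a..b}" for a b
    by (rule integrable_continuous_real[OF continuous_on_subset[OF cg]]) simp
  have cnj: "g (- y) = cnj (g y)" for y
  proof -
    have "recip_kappa (cnj (\<i> * of_real y)) = cnj (recip_kappa (\<i> * of_real y))"
      unfolding recip_kappa_def by (simp only: log_kappa_cnj exp_cnj complex_cnj_minus)
    then show ?thesis by (simp add: g_def)
  qed
  define J where "J = integral {0..R} (\<lambda>y. recip_kappa_ext (\<i> * of_real y) / (\<i> * of_real y + of_real \<theta>))"
  have "integral {-R..R} g = integral {-R..0} g + integral {0..R} g"
    using assms gi by (intro Henstock_Kurzweil_Integration.integral_combine[symmetric]) auto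
  also have refl: "integral {-R..0} g = integral {0..R} (\<lambda>y. g (- y))"
    using Henstock_Kurzweil_Integration.integral_reflect_real[of R 0 "\<lambda>y. g (- y)"] by simp
  also have "integral {0..R} (\<lambda>y. g (- y)) = integral {0..R} (\<lambda>y. - (recip_kappa_ext (\<i> * of_real y) / (\<i> * of_real y + of_real \<theta>)))"
  \<comment> \<open>The factorization is available for z > 0, so the point y = 0 is removed as a
    null set.\<close>
  proof (rule integral_spike[of "{0}"])
    fix y assume "y \<in> {0..R} - {0}"
    then have "recip_kappa (- (\<i> * of_real y)) = recip_kappa_ext (\<i> * of_real y)" by (intro recip_kappa_eq_recip_kappa_ext) auto
    moreover have "- (\<i> * of_real y) - of_real \<theta> = - (\<i> * of_real y + of_real \<theta>)" by simp
    ultimately show "- (recip_kappa_ext (\<i> * of_real y) / (\<i> * of_real y + of_real \<theta>)) = g (- y)"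
      unfolding g_def of_real_minus mult_minus_right by (simp only: divide_minus_right)
  qed auto
  also have "\<dots> = - J" by (simp add: J_def)
  finally have 1: "integral {-R..R} g = - J + integral {0..R} g" .
  have "integral {0..R} g = cnj (integral {0..R} (\<lambda>y. g (- y)))"
    by (simp add: Henstock_Kurzweil_Integration.integral_cnj cnj)
  also have "integral {0..R} (\<lambda>y. g (- y)) = - J"
    using 1 refl assms gi Henstock_Kurzweil_Integration.integral_combine[of "- R" 0 R g] by simp
  finally have "integral {-R..R} g = - (J + cnj J)" using 1 by simp
  then show ?thesis by (simp add: g_def[abs_def] J_def complex_add_cnj)
qed

text \<open>Imaginary parts of the two contour identities eliminate the integral over the imaginary
  axis: pi / kappa differs from the integral over [0, R] by far-side errors that vanish as R grows.
  The limit is one of improper integrals; nonnegativity of the density makes it a Lebesgue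
  integral.\<close>

lemma stieltjes_inversion:
  assumes "0 < \<theta>" "0 < phi" "phi < pi"
  shows "(LBINT x:{0<..}. Im (recip_kappa_ext (of_real x)) / (x + \<theta>)) = pi * exp (- Re (log_kappa \<alpha> N (of_real \<theta>)))"
proof -
  define k where "k = exp (- Re (log_kappa \<alpha> N (of_real \<theta>)))"
  define h where "h x = Im (recip_kappa_ext (of_real x)) / (x + \<theta>)" for x
  \<comment> \<open>The error of the quadrant counts twice because both halves of the imaginary axis
    are moved to the cut, one directly and one by conjugation.\<close>
  define e where "e R = 4 * (exp (4 * \<alpha>) * R powr (- (Re (positive_laplace N 1) * \<alpha>)) / (R - \<theta>)) * R +
    2 * (2 * (2 * exp (4 * \<alpha> + Re (log_kappa \<alpha> dual 1)) * R powr (- (phi / pi)) / R) * R)" for R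
  have q: "Re (positive_laplace N 1) * \<alpha> > 0"
    using assms alpha phi_prob Re_positive_laplace_1_pos by (simp add: zero_less_mult_iff)
  have Fc: "continuous_on {0..} (\<lambda>x. Im (recip_kappa_ext (of_real x)))"
    by (intro continuous_intros continuous_on_compose2[OF continuous_on_recip_kappa_ext[OF assms(3)]]) auto
  have hc: "continuous_on {0..} h"
    unfolding h_def using assms by (intro continuous_intros Fc) auto
  have triangle: "\<bar>d\<bar> \<le> (b1 + 2 * b2) / 2"
    if "d = (i1 + 2 * i2) / 2" "\<bar>i1\<bar> \<le> n1" "\<bar>i2\<bar> \<le> n2" "n1 \<le> b1" "n2 \<le> b2" for d i1 i2 n1 n2 b1 b2 :: real
  proof -
    have "\<bar>i1 + 2 * i2\<bar> \<le> b1 + 2 * b2" using that(2-5) by linarith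
    then show ?thesis unfolding that(1) by simp
  qed
  have main: "\<bar>pi * k - integral {0..R} h\<bar> \<le> e R / 2"
    if R: "\<theta> < R" "1 \<le> R" "2 \<le> R powr \<alpha>" for R
  proof -
    define I where "I = integral {0..R} (\<lambda>x. recip_kappa_ext (of_real x) / (of_real x + of_real \<theta>))"
    define J where "J = integral {0..R} (\<lambda>y. recip_kappa_ext (\<i> * of_real y) / (\<i> * of_real y + of_real \<theta>))"
    obtain E1 where E1: "2 * pi * \<i> * recip_kappa (of_real \<theta>) = E1 - \<i> * integral {-R..R} (\<lambda>y. recip_kappa (\<i> * of_real y) / (\<i> * of_real y - of_real \<theta>))"
      "norm E1 \<le> 4 * (exp (4 * \<alpha>) * R powr (- (Re (positive_laplace N 1) * \<alpha>)) / (R - \<theta>)) * R"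
      using recip_kappa_contour[of \<theta> R] assms R by auto
    obtain E2 where E2: "\<i> * J = I + E2"
      "norm E2 \<le> 2 * (2 * exp (4 * \<alpha> + Re (log_kappa \<alpha> dual 1)) * R powr (- (phi / pi)) / R) * R"
      "(\<lambda>x. recip_kappa_ext (of_real x) / (of_real x + of_real \<theta>)) integrable_on {0..R}"
      using recip_kappa_ext_contour[of \<theta> R] assms R unfolding I_def J_def by auto
    have "Im I = integral {0..R} (\<lambda>x. Im (recip_kappa_ext (of_real x) / (of_real x + of_real \<theta>)))"
      unfolding I_def using integral_linear[OF E2(3) bounded_linear_Im] by (simp add: comp_def)
    also have "\<dots> = integral {0..R} h"
      by (rule integral_cong) (simp add: h_def flip: of_real_add)
    finally have ImI: "Im I = integral {0..R} h" .
    have "2 * pi * \<i> * of_real k = E1 + \<i> * of_real (2 * Re J)"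
      using E1(1) integral_imaginary_axis_recip_kappa[of \<theta> R] recip_kappa_of_real[of \<theta>] assms R by (simp add: J_def k_def)
    then have "2 * pi * k = Im E1 + 2 * Re J" by (simp add: complex_eq_iff)
    moreover have "Re J = Im I + Im E2" using E2(1) by (simp add: complex_eq_iff)
    ultimately have "pi * k - integral {0..R} h = (Im E1 + 2 * Im E2) / 2" by (simp add: ImI)
    moreover have "\<bar>Im E1\<bar> \<le> norm E1" "\<bar>Im E2\<bar> \<le> norm E2" by (rule abs_Im_le_cmod)+
    ultimately show ?thesis using E1(2) E2(2) unfolding e_def by (rule triangle)
  qed
  have "((\<lambda>R. e R / 2) \<longlongrightarrow> 0) at_top"
  proof -
    have 1: "((\<lambda>R. R powr (- a) / (R - \<theta>) * R) \<longlongrightarrow> 0) at_top" if "a > 0" for a :: real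
      using that by real_asymp
    have 2: "((\<lambda>R. R powr (- a) / R * R) \<longlongrightarrow> 0) at_top" if "a > 0" for a :: real
      using that by real_asymp
    have "phi / pi > 0" using assms by simp
    from tendsto_add[OF tendsto_mult_right_zero[OF 1[OF q], of "2 * exp (4 * \<alpha>)"]
        tendsto_mult_right_zero[OF 2[OF this], of "4 * exp (4 * \<alpha> + Re (log_kappa \<alpha> dual 1))"]]
    have "((\<lambda>R. 2 * exp (4 * \<alpha>) * (R powr (- (Re (positive_laplace N 1) * \<alpha>)) / (R - \<theta>) * R) +
        4 * exp (4 * \<alpha> + Re (log_kappa \<alpha> dual 1)) * (R powr (- (phi / pi)) / R * R)) \<longlongrightarrow> 0) at_top"
      by simp
    moreover have "(4 * (a * p / d) * R + 2 * (2 * (2 * b * p' / d') * R)) / 2 = 2 * a * (p / d * R) + 4 * b * (p' / d' * R)"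
      for a b p p' d d' R :: real
    proof -
      have "(4 * (a * u) * R + 2 * (2 * (2 * b * v) * R)) / 2 = 2 * a * (u * R) + 4 * b * (v * R)" for u v
        by (simp add: algebra_simps)
      from this[of "p / d" "p' / d'"] show ?thesis by (simp only: times_divide_eq_right)
    qed
    ultimately show ?thesis unfolding e_def by (simp only:)
  qed
  moreover have "\<forall>\<^sub>F R in at_top. norm (integral {0..R} h - pi * k) \<le> e R / 2"
  proof -
    have "\<forall>\<^sub>F R in at_top. 2 \<le> R powr \<alpha>" using alpha by real_asymp
    moreover have "\<forall>\<^sub>F R in at_top. \<theta> < R" "\<forall>\<^sub>F R in at_top. (1::real) \<le> R"
      by (rule eventually_gt_at_top eventually_ge_at_top)+
    ultimately show ?thesis by eventually_elim (use main in \<open>simp add: abs_minus_commute\<close>)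
  qed
  ultimately have "((\<lambda>R. integral {0..R} h - pi * k) \<longlongrightarrow> 0) at_top"
    by (rule Lim_null_comparison[rotated])
  then have lim: "((\<lambda>R. integral {0..R} h) \<longlongrightarrow> pi * k) at_top"
    by (simp add: LIM_zero_iff)
  \<comment> \<open>The denominator is (x^\<alpha> + cos phi)^2 + (sin phi)^2, and sin phi > 0; the
    sign is what allows monotone convergence below.\<close>
  have nonneg: "h x \<ge> 0" if "x > 0" for x
  proof -
    have "x powr (2 * \<alpha>) + 2 * x powr \<alpha> * cos phi + 1 = (x powr \<alpha> + cos phi)\<^sup>2 + (sin phi)\<^sup>2"
      by (simp add: power2_sum power_mult_distrib powr_add[symmetric] power2_eq_square[of "x powr \<alpha>"] cos_squared_eq mult_ac)
    moreover have "sin phi > 0" using assms by (intro sin_gt_zero) auto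
    ultimately show ?thesis
      unfolding h_def Im_recip_kappa_ext_of_real[OF that] using that assms by simp
  qed
  have ind: "indicator {0<..} x *\<^sub>R h x * indicator {..R} x = indicator {0<..R} x *\<^sub>R h x" for x R
    by (auto simp: indicator_def)
  have int: "set_integrable lborel {0..R} h" for R
    using hc by (intro borel_integrable_atLeastAtMost' continuous_on_subset[OF hc]) auto
  have int': "set_integrable lborel {0<..R} h" for R
    by (rule set_integrable_subset[OF int[of R]]) auto
  have val: "(LBINT x:{0<..R}. h x) = integral {0..R} h" for R
  proof -
    have "(LBINT x:{0<..R}. h x) = (LBINT x:{0..R}. h x)"
      unfolding set_lebesgue_integral_def
      using AE_lborel_singleton[of 0] int int'
      by (intro integral_cong_AE) (auto simp: indicator_def set_integrable_def elim!: eventually_mono)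
    also have "\<dots> = integral {0..R} h" by (rule set_borel_integral_eq_integral(2)[OF int])
    finally show ?thesis .
  qed
  have "(LBINT x. indicator {0<..} x *\<^sub>R h x) = pi * k"
  proof (rule integral_monotone_convergence_at_top)
    show "(\<lambda>x. indicator {0<..} x *\<^sub>R h x) \<in> borel_measurable borel"
      by (rule borel_measurable_continuous_on_indicator[OF _ continuous_on_subset[OF hc]]) auto
    show "integrable lborel (\<lambda>x. indicator {0<..} x *\<^sub>R h x * indicator {..y} x)" for y
      unfolding ind using int' by (simp add: set_integrable_def)
    show "((\<lambda>y. LBINT x. indicator {0<..} x *\<^sub>R h x * indicator {..y} x) \<longlongrightarrow> pi * k) at_top"
      unfolding ind val[unfolded set_lebesgue_integral_def] by (rule lim)
  qed (use nonneg in \<open>auto simp: indicator_def\<close>)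
  then show ?thesis by (simp add: set_lebesgue_integral_def h_def k_def)
qed

end

section \<open>Stable convolution semigroups\<close>

text \<open>Fristedt's integral sees a process through its one-dimensional laws, recorded here by
  their characteristic functions. Both the process and its dual give instances, with opposite signs
  of \<gamma>.\<close>

locale stable_semigroup =
  fixes \<mu> :: "real \<Rightarrow> real measure" and \<alpha> \<gamma> :: real
  assumes alpha: "0 < \<alpha>" "\<alpha> < 2" and gamma: "\<bar>\<gamma>\<bar> < pi / 2"
    and real_distribution: "\<And>t. t > 0 \<Longrightarrow> real_distribution (\<mu> t)"
    and char_law: "\<And>t z. t > 0 \<Longrightarrow> char (\<mu> t) z = exp (- (of_real t * stable_symbol \<alpha> \<gamma> z))"
begin

sublocale one: real_distribution "\<mu> 1" by (rule real_distribution) simp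

lemma symbol_scale:
  assumes "t > 0"
  shows "stable_symbol \<alpha> \<gamma> (t powr (1 / \<alpha>) * z) = of_real t * stable_symbol \<alpha> \<gamma> z"
  using assms alpha by (simp add: stable_symbol_def abs_mult powr_mult powr_powr sgn_mult)

lemmas Re_symbol_nonneg = Re_stable_symbol_nonneg[OF gamma, of \<alpha>]

lemma char_scale: "t > 0 \<Longrightarrow> char (\<mu> 1) (t powr (1 / \<alpha>) * z) = exp (- (of_real t * stable_symbol \<alpha> \<gamma> z))"
  by (simp add: char_law symbol_scale)

lemma law_scale:
  assumes t: "t > 0"
  shows "\<mu> t = distr (\<mu> 1) borel (\<lambda>x. t powr (1 / \<alpha>) * x)"
proof (rule Levy_uniqueness)
  show "real_distribution (\<mu> t)" by (rule real_distribution[OF t])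
  show "real_distribution (distr (\<mu> 1) borel (\<lambda>x. t powr (1 / \<alpha>) * x))"
    by (rule one.real_distribution_distr) simp
  show "char (\<mu> t) = char (distr (\<mu> 1) borel (\<lambda>x. t powr (1 / \<alpha>) * x))"
  proof
    fix z
    have "char (distr (\<mu> 1) borel (\<lambda>x. t powr (1 / \<alpha>) * x)) z = char (\<mu> 1) (t powr (1 / \<alpha>) * z)"
      unfolding char_def by (subst integral_distr) (auto simp: mult_ac)
    then show "char (\<mu> t) z = char (distr (\<mu> 1) borel (\<lambda>x. t powr (1 / \<alpha>) * x)) z"
      using t by (simp add: char_law symbol_scale)
  qed
qed

definition exp_time :: "real measure" where
  "exp_time = density lborel (\<lambda>t. ennreal (indicator {0<..} t * exp (- t)))"

text \<open>By self-similarity this is the law of the process at an independent exponential time.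
  Building it from the single law \<open>\<mu> 1\<close> makes it the image of a product measure, so
  that no measurability of the family \<open>\<mu>\<close> in t has to be established.\<close>

definition mix :: "real measure" where
  "mix = distr (exp_time \<Otimes>\<^sub>M \<mu> 1) borel (\<lambda>(t, x). t powr (1 / \<alpha>) * x)"

lemma exp_time: "prob_space exp_time"
proof
  have "emeasure exp_time (space exp_time) = (\<integral>\<^sup>+t. ennreal (indicator {0<..} t * exp (- t)) \<partial>lborel)"
    by (simp add: exp_time_def emeasure_density)
  also have "\<dots> = 1"
    using has_bochner_integral_I0i_power_exp_m[of 0]
    by (subst nn_integral_eq_integral) (auto simp: has_bochner_integral_iff mult.commute)
  finally show "emeasure exp_time (space exp_time) = 1" .
qed

sublocale E: prob_space exp_time by (rule exp_time)
sublocale pair: pair_prob_space exp_time "\<mu> 1" by unfold_locales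

lemma sets_exp_time [measurable_cong, simp]: "sets exp_time = sets borel"
  by (simp add: exp_time_def)

lemma measurable_mix [measurable]: "(\<lambda>(t, x). t powr (1 / \<alpha>) * x) \<in> borel_measurable (exp_time \<Otimes>\<^sub>M \<mu> 1)"
  by measurable

lemma nn_integral_mix:
  assumes [measurable]: "g \<in> borel_measurable borel"
  shows "(\<integral>\<^sup>+y. g y \<partial>mix) = (\<integral>\<^sup>+t. ennreal (indicator {0<..} t * exp (- t)) * (\<integral>\<^sup>+x. g (t powr (1 / \<alpha>) * x) \<partial>\<mu> 1) \<partial>lborel)"
proof -
  have "(\<integral>\<^sup>+y. g y \<partial>mix) = (\<integral>\<^sup>+p. g (case p of (t, x) \<Rightarrow> t powr (1 / \<alpha>) * x) \<partial>(exp_time \<Otimes>\<^sub>M \<mu> 1))"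
    unfolding mix_def by (rule nn_integral_distr) auto
  also have "\<dots> = (\<integral>\<^sup>+t. \<integral>\<^sup>+x. g (t powr (1 / \<alpha>) * x) \<partial>\<mu> 1 \<partial>exp_time)"
    by (subst one.nn_integral_fst[symmetric]) simp_all
  also have "\<dots> = (\<integral>\<^sup>+t. ennreal (indicator {0<..} t * exp (- t)) * (\<integral>\<^sup>+x. g (t powr (1 / \<alpha>) * x) \<partial>\<mu> 1) \<partial>lborel)"
    unfolding exp_time_def by (subst nn_integral_density) auto
  finally show ?thesis .
qed

lemma char_mix: "char mix z = 1 / (1 + stable_symbol \<alpha> \<gamma> z)"
proof -
  let ?s = "stable_symbol \<alpha> \<gamma> z"
  have int: "integrable (exp_time \<Otimes>\<^sub>M \<mu> 1) (\<lambda>p. iexp (z * (case p of (t, x) \<Rightarrow> t powr (1 / \<alpha>) * x)))"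
    by (rule pair.P.integrable_iexp) auto
  have "char mix z = (\<integral>p. iexp (z * (case p of (t, x) \<Rightarrow> t powr (1 / \<alpha>) * x)) \<partial>(exp_time \<Otimes>\<^sub>M \<mu> 1))"
    unfolding char_def mix_def by (rule integral_distr) auto
  also have "\<dots> = (\<integral>t. (\<integral>x. iexp (z * (t powr (1 / \<alpha>) * x)) \<partial>\<mu> 1) \<partial>exp_time)"
    using pair.integral_fst'[OF int] by simp
  also have "\<dots> = (\<integral>t. char (\<mu> 1) (t powr (1 / \<alpha>) * z) \<partial>exp_time)"
    by (simp add: char_def mult_ac)
  also have "\<dots> = (LBINT t. (indicator {0<..} t * exp (- t)) *\<^sub>R char (\<mu> 1) (t powr (1 / \<alpha>) * z))"
    unfolding exp_time_def by (rule integral_density) auto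
  also have "\<dots> = (LBINT t:{0<..}. exp (- (1 + ?s) * of_real t))"
    unfolding set_lebesgue_integral_def
  proof (intro Bochner_Integration.integral_cong refl)
    fix t :: real
    show "(indicator {0<..} t * exp (- t)) *\<^sub>R char (\<mu> 1) (t powr (1 / \<alpha>) * z) = indicator {0<..} t *\<^sub>R exp (- (1 + ?s) * of_real t)"
    proof (cases "t > 0")
      case True
      have "exp (- t) *\<^sub>R exp (- (of_real t * ?s)) = exp (of_real (- t) + - (of_real t * ?s))"
        by (simp only: scaleR_conv_of_real exp_of_real exp_add)
      also have "of_real (- t) + - (of_real t * ?s) = - (1 + ?s) * of_real t"
        by (simp add: algebra_simps)
      finally show ?thesis using True by (simp add: char_scale)
    qed simp
  qed
  also have "\<dots> = 1 / (1 + ?s)"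
    using Re_symbol_nonneg[of z] by (intro LBINT_exp_minus) simp
  finally show ?thesis .
qed

sublocale mix: stable_exp_law mix \<alpha> \<gamma>
proof -
  have "real_distribution mix"
    unfolding mix_def by (rule pair.P.real_distribution_distr) measurable
  then show "stable_exp_law mix \<alpha> \<gamma>"
    by (intro stable_exp_law.intro stable_exp_law_axioms.intro alpha gamma char_mix)
qed

lemma nn_integral_exp_minus:
  assumes "t > 0"
  shows "(\<integral>\<^sup>+v. ennreal (indicator {1..} v * exp (- (t * v))) \<partial>lborel) = ennreal (exp (- t) / t)"
proof -
  have "(\<integral>\<^sup>+v. ennreal (exp (- (t * v))) * indicator {1..} v \<partial>lborel) = 0 - (- exp (- (t * 1)) / t)"
  proof (rule nn_integral_FTC_atLeast)
    show "((\<lambda>v. - exp (- (t * v)) / t) has_real_derivative exp (- (t * x))) (at x)" for x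
      using assms by (auto intro!: derivative_eq_intros)
    show "((\<lambda>v. - exp (- (t * v)) / t) \<longlongrightarrow> 0) at_top"
      using assms by real_asymp
  qed auto
  moreover have "(\<integral>\<^sup>+v. ennreal (indicator {1..} v * exp (- (t * v))) \<partial>lborel) = (\<integral>\<^sup>+v. ennreal (exp (- (t * v))) * indicator {1..} v \<partial>lborel)"
    by (intro nn_integral_cong) (auto simp: indicator_def)
  ultimately show ?thesis by simp
qed

text \<open>With \<eta> = 1 the inner integrand is exp(-t) / t times 1 - exp(-\<theta>x), hence
  nonnegative. Both sides are iterated integrals of one nonnegative kernel in (t, v), and Tonelli
  exchanges them.\<close>

lemma ladder_integral:
  assumes theta: "\<theta> > 0"
  shows "(LBINT t:{0<..}. (LINT x:{0<..}|\<mu> t. (exp (- t) - exp (- t - \<theta> * x)) / t)) = Re (log_kappa \<alpha> mix (of_real \<theta>))"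
proof -
  \<comment> \<open>For s > 0 the value \<open>k (s * x)\<close> also carries the restriction to x >
    0, so scaling the law acts on the argument alone.\<close>
  define k where "k y = indicator {0<..} y * (1 - exp (- y))" for y :: real
  have k0: "0 \<le> k y" "k y \<le> 1" for y by (auto simp: k_def indicator_def)
  have [measurable]: "k \<in> borel_measurable borel" unfolding k_def[abs_def] by measurable
  have ki: "integrable (\<mu> 1) (\<lambda>x. c * k (s * x))" for c s
    using k0 by (intro integrable_mult_right one.integrable_const_bound[where B = 1]) auto
  define G where "G s = (\<integral>\<^sup>+x. ennreal (k (s * x)) \<partial>\<mu> 1)" for s
  have [measurable]: "G \<in> borel_measurable borel" unfolding G_def[abs_def] by measurable
  have GI: "ennreal c * G s = ennreal (\<integral>x. c * k (s * x) \<partial>\<mu> 1)" if "c \<ge> 0" for c s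
  proof -
    have "ennreal c * G s = (\<integral>\<^sup>+x. ennreal (c * k (s * x)) \<partial>\<mu> 1)"
      unfolding G_def using that k0 by (subst nn_integral_cmult[symmetric]) (auto simp: ennreal_mult)
    also have "\<dots> = ennreal (\<integral>x. c * k (s * x) \<partial>\<mu> 1)"
      using that k0 by (intro nn_integral_eq_integral ki) auto
    finally show ?thesis .
  qed
  define f where "f t = indicator {0<..} t * (\<integral>x. exp (- t) / t * k (\<theta> * t powr (1 / \<alpha>) * x) \<partial>\<mu> 1)" for t
  have fm: "f \<in> borel_measurable borel" unfolding f_def[abs_def] by measurable
  have f0: "f t \<ge> 0" for t
    unfolding f_def using k0 by (auto simp: indicator_def intro!: Bochner_Integration.integral_nonneg)
  have inner: "indicator {0<..} t *\<^sub>R (LINT x:{0<..}|\<mu> t. (exp (- t) - exp (- t - \<theta> * x)) / t) = f t" for t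
  proof (cases "t > 0")
    case True
    have "(LINT x:{0<..}|\<mu> t. (exp (- t) - exp (- t - \<theta> * x)) / t) = (\<integral>x. exp (- t) / t * k (\<theta> * x) \<partial>\<mu> t)"
      unfolding set_lebesgue_integral_def
      using theta by (intro Bochner_Integration.integral_cong refl)
        (auto simp: k_def indicator_def zero_less_mult_iff exp_diff exp_minus field_simps)
    also have "\<dots> = (\<integral>x. exp (- t) / t * k (\<theta> * (t powr (1 / \<alpha>) * x)) \<partial>\<mu> 1)"
      unfolding law_scale[OF True] by (rule integral_distr) auto
    finally show ?thesis using True by (simp add: f_def mult.assoc)
  qed (simp add: f_def)
  define g where "g v = indicator {1..} v * (Re (positive_laplace mix (of_real (\<theta> * v powr (- 1 / \<alpha>)))) / v)" for v
  have gm: "g \<in> borel_measurable borel"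
    unfolding g_def[abs_def] using mix.measurable_positive_laplace by measurable
  have g0: "g v \<ge> 0" for v
    using theta mix.Re_positive_laplace_nonneg[of "\<theta> * v powr (- 1 / \<alpha>)"] by (auto simp: g_def indicator_def)
  have Re_log_kappa: "Re (log_kappa \<alpha> mix (of_real \<theta>)) = (LBINT v. g v)"
  proof -
    have "Re (log_kappa \<alpha> mix (of_real \<theta>)) = (LBINT v. Re (indicator {1..} v *\<^sub>R (positive_laplace mix (of_real \<theta> * of_real (v powr (- 1 / \<alpha>))) / of_real v)))"
      unfolding mix.log_kappa_alt using theta by (intro integral_Re[symmetric] mix.integrable_log_kappa) simp
    then show ?thesis by (simp add: g_def[abs_def])
  qed
  have gG: "ennreal (g v) = (\<integral>\<^sup>+t. ennreal (indicator {1..} v) * (ennreal (indicator {0<..} t * exp (- (t * v))) * G (\<theta> * t powr (1 / \<alpha>))) \<partial>lborel)" for v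
  proof (cases "v \<ge> 1")
    case True
    define s where "s = \<theta> * v powr (- 1 / \<alpha>)"
    have s: "s > 0" using True theta by (simp add: s_def)
    have "ennreal (Re (positive_laplace mix (of_real s))) = ennreal (\<integral>y. k (s * y) \<partial>mix)"
      using s by (subst mix.Re_positive_laplace_of_real) (auto simp: k_def indicator_def zero_less_mult_iff)
    also have "\<dots> = (\<integral>\<^sup>+y. ennreal (k (s * y)) \<partial>mix)"
      using k0 by (intro nn_integral_eq_integral[symmetric] mix.integrable_const_bound[where B = 1]) auto
    also have "\<dots> = (\<integral>\<^sup>+r. ennreal (indicator {0<..} r * exp (- r)) * G (s * r powr (1 / \<alpha>)) \<partial>lborel)"
      by (subst nn_integral_mix) (auto simp: G_def mult_ac)
    \<comment> \<open>Substitution r = v t in the exponential time: exp(-r) becomes exp(-t v), and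
      the power of v t cancels the factor \<open>v powr (- 1 / \<alpha>)\<close> contained in
      \<open>s\<close>.\<close>
    also have "\<dots> = ennreal \<bar>v\<bar> * (\<integral>\<^sup>+t. ennreal (indicator {0<..} (0 + v * t) * exp (- (0 + v * t))) * G (s * (0 + v * t) powr (1 / \<alpha>)) \<partial>lborel)"
      using True by (intro nn_integral_real_affine) auto
    also have "(\<integral>\<^sup>+t. ennreal (indicator {0<..} (0 + v * t) * exp (- (0 + v * t))) * G (s * (0 + v * t) powr (1 / \<alpha>)) \<partial>lborel)
        = (\<integral>\<^sup>+t. ennreal (indicator {0<..} t * exp (- (t * v))) * G (\<theta> * t powr (1 / \<alpha>)) \<partial>lborel)"
    proof (intro nn_integral_cong)
      fix t :: real
      show "ennreal (indicator {0<..} (0 + v * t) * exp (- (0 + v * t))) * G (s * (0 + v * t) powr (1 / \<alpha>))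
        = ennreal (indicator {0<..} t * exp (- (t * v))) * G (\<theta> * t powr (1 / \<alpha>))"
      proof (cases "t > 0")
        case t: True
        have "s * (v * t) powr (1 / \<alpha>) = \<theta> * t powr (1 / \<alpha>)"
          using True t by (simp add: s_def powr_mult powr_minus)
        then show ?thesis using True t by (simp add: mult.commute)
      next
        case False
        then have "\<not> 0 < v * t" using True by (simp add: zero_less_mult_iff)
        then show ?thesis using False by simp
      qed
    qed
    finally have "ennreal (Re (positive_laplace mix (of_real s)))
        = (\<integral>\<^sup>+t. ennreal (indicator {0<..} t * exp (- (t * v))) * G (\<theta> * t powr (1 / \<alpha>)) \<partial>lborel) * ennreal v"
      using True by (simp add: mult.commute)
    then have "ennreal (Re (positive_laplace mix (of_real s)) / v)
        = (\<integral>\<^sup>+t. ennreal (indicator {0<..} t * exp (- (t * v))) * G (\<theta> * t powr (1 / \<alpha>)) \<partial>lborel)"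
      using True mix.Re_positive_laplace_nonneg[of s] s
      by (subst divide_ennreal[symmetric]) (auto simp: ennreal_mult_divide_eq)
    then show ?thesis using True by (simp add: g_def s_def)
  qed (simp add: g_def)
  have ff: "ennreal (f t) = (\<integral>\<^sup>+v. ennreal (indicator {1..} v) * (ennreal (indicator {0<..} t * exp (- (t * v))) * G (\<theta> * t powr (1 / \<alpha>))) \<partial>lborel)" for t
  proof (cases "t > 0")
    case True
    have "ennreal (f t) = ennreal (exp (- t) / t) * G (\<theta> * t powr (1 / \<alpha>))"
      using True by (subst GI) (auto simp: f_def)
    also have "\<dots> = (\<integral>\<^sup>+v. ennreal (indicator {1..} v * exp (- (t * v))) \<partial>lborel) * G (\<theta> * t powr (1 / \<alpha>))"
      by (simp add: nn_integral_exp_minus[OF True])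
    also have "\<dots> = (\<integral>\<^sup>+v. ennreal (indicator {1..} v * exp (- (t * v))) * G (\<theta> * t powr (1 / \<alpha>)) \<partial>lborel)"
      by (rule nn_integral_multc[symmetric]) auto
    also have "\<dots> = (\<integral>\<^sup>+v. ennreal (indicator {1..} v) * (ennreal (indicator {0<..} t * exp (- (t * v))) * G (\<theta> * t powr (1 / \<alpha>))) \<partial>lborel)"
      using True by (intro nn_integral_cong) (auto simp: indicator_def)
    finally show ?thesis .
  qed (simp add: f_def)
  have "(LBINT t:{0<..}. (LINT x:{0<..}|\<mu> t. (exp (- t) - exp (- t - \<theta> * x)) / t)) = (LBINT t. f t)"
    unfolding set_lebesgue_integral_def[of lborel] inner ..
  also have "\<dots> = enn2real (\<integral>\<^sup>+t. ennreal (f t) \<partial>lborel)"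
    using fm f0 by (intro integral_eq_nn_integral) auto
  also have "(\<integral>\<^sup>+t. ennreal (f t) \<partial>lborel) = (\<integral>\<^sup>+v. ennreal (g v) \<partial>lborel)"
    unfolding ff gG by (rule lborel_pair.Fubini') measurable
  also have "enn2real \<dots> = (LBINT v. g v)"
    using gm g0 by (intro integral_eq_nn_integral[symmetric]) auto
  finally show ?thesis by (simp add: Re_log_kappa)
qed


text \<open>Multiplication by the positive number \<open>t powr (1 / \<alpha>)\<close> preserves
  signs. The half-line formula for \<open>mix\<close> thus yields the positivity coefficient, which
  is defined at time 1.\<close>

lemma measure_mix_nonneg: "measure mix {0..} = measure (\<mu> 1) {0..}"
proof -
  have "emeasure mix {0..} = (\<integral>\<^sup>+y. indicator {0..} y \<partial>mix)"
    by simp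
  also have "\<dots> = (\<integral>\<^sup>+t. ennreal (indicator {0<..} t * exp (- t)) * emeasure (\<mu> 1) {0..} \<partial>lborel)"
  proof (subst nn_integral_mix, simp, intro nn_integral_cong)
    fix t :: real
    have "t > 0 \<Longrightarrow> (\<integral>\<^sup>+x. indicator {0..} (t powr (1 / \<alpha>) * x) \<partial>\<mu> 1) = (\<integral>\<^sup>+x. indicator {0..} x \<partial>\<mu> 1)"
      by (intro nn_integral_cong) (auto simp: indicator_def zero_le_mult_iff not_le)
    then show "ennreal (indicator {0<..} t * exp (- t)) * (\<integral>\<^sup>+x. indicator {0..} (t powr (1 / \<alpha>) * x) \<partial>\<mu> 1)
        = ennreal (indicator {0<..} t * exp (- t)) * emeasure (\<mu> 1) {0..}"
      by (cases "t > 0") auto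
  qed
  also have "\<dots> = emeasure exp_time (space exp_time) * emeasure (\<mu> 1) {0..}"
    by (subst nn_integral_multc) (auto simp: exp_time_def emeasure_density)
  finally show ?thesis by (simp add: E.emeasure_space_1 measure_def)
qed

end

section \<open>The skewness parameter and the final identity\<close>

lemma stable_exponent_eq_symbol:
  "stable_exponent \<alpha> \<beta> z = stable_symbol \<alpha> (arctan (\<beta> * tan (pi * \<alpha> / 2))) z"
proof -
  \<comment> \<open>With b = tan \<gamma>, dividing 1 and b by sqrt(1 + b^2) gives cos \<gamma> and
    sin \<gamma>; the normalising constant of the exponent is exactly what makes its modulus
    |z|^\<alpha>.\<close>
  define b where "b = \<beta> * tan (pi * \<alpha> / 2)"
  have "0 < 1 + b\<^sup>2" by (intro add_pos_nonneg) auto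
  then have "sqrt (1 + b\<^sup>2) \<noteq> 0" by simp
  then show ?thesis
    unfolding stable_exponent_def stable_symbol_def b_def[symmetric]
    by (cases z "0::real" rule: linorder_cases)
      (auto simp: complex_eq_iff cos_arctan sin_arctan sgn_if field_simps)
qed

text \<open>For \<alpha> < 1 the tangent is positive and the arctangent is at most pi \<alpha> / 2;
  for \<alpha> > 1 the tangent has modulus tan(pi - pi \<alpha> / 2), so the arctangent is at most
  pi - pi \<alpha> / 2. In probabilistic terms this is \<alpha> \<rho> \<le> 1, with equality when
  \<alpha> > 1 and \<beta> = -1.\<close>

lemma skew_angle_le:
  assumes "0 < \<alpha>" "\<alpha> < 2" "- 1 \<le> \<beta>" "\<beta> \<le> 1" "\<alpha> = 1 \<Longrightarrow> \<beta> = 0"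
  shows "pi * \<alpha> / 2 + arctan (\<beta> * tan (pi * \<alpha> / 2)) \<le> pi"
proof -
  have le: "arctan (\<beta> * x) \<le> y" if "\<bar>x\<bar> = tan y" "- pi / 2 < y" "y < pi / 2" for x y
  proof -
    have "\<beta> * x \<le> \<bar>\<beta>\<bar> * \<bar>x\<bar>" by (metis abs_ge_self abs_mult)
    also have "\<dots> \<le> \<bar>x\<bar>" using assms by (intro mult_left_le_one_le) auto
    finally have "\<beta> * x \<le> tan y" using that by simp
    then have "arctan (\<beta> * x) \<le> arctan (tan y)" by (simp only: arctan_le_iff)
    then show ?thesis using that by (simp add: arctan_tan)
  qed
  consider "\<alpha> < 1" | "\<alpha> = 1" | "\<alpha> > 1" by linarith
  then show ?thesis
  proof cases
    case 1
    then have y: "0 < pi * \<alpha> / 2" "pi * \<alpha> / 2 < pi / 2" using assms by auto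
    then have "arctan (\<beta> * tan (pi * \<alpha> / 2)) \<le> pi * \<alpha> / 2"
      using tan_gt_zero[OF y] y pi_gt_zero by (intro le) linarith+
    then show ?thesis using y by linarith
  next
    case 2
    then show ?thesis using assms by simp
  next
    case 3
    have y: "0 < pi - pi * \<alpha> / 2" "pi - pi * \<alpha> / 2 < pi / 2"
      using 3 assms by (simp_all add: field_simps)
    have "tan (pi * \<alpha> / 2) = tan (- (pi - pi * \<alpha> / 2))"
      using tan_periodic_pi[of "- (pi - pi * \<alpha> / 2)"] by simp
    then have "tan (pi * \<alpha> / 2) = - tan (pi - pi * \<alpha> / 2)" by (simp only: tan_minus)
    then have "arctan (\<beta> * tan (pi * \<alpha> / 2)) \<le> pi - pi * \<alpha> / 2"
      using tan_gt_zero[OF y] y pi_gt_zero by (intro le) linarith+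
    then show ?thesis by simp
  qed
qed

theorem proposition1:
  fixes M :: "'a measure" and X :: "real \<Rightarrow> 'a \<Rightarrow> real"
    and \<alpha> \<beta> \<rho> \<theta> :: real
  assumes "0 < \<alpha>" "\<alpha> < 2"
    and "strictly_stable_process \<alpha> \<beta> M X"
    and "\<rho> = positivity_coefficient M X"
    and "\<rho> \<in> {0<..1} - {1 / \<alpha>}"
    and "\<theta> > 0"
  shows "sin (\<rho> * \<alpha> * pi) / pi *
      (LBINT x:{0<..}. 1 / (x + \<theta>) *
        (x powr \<alpha> * ladder_exponent M (dual_process X) 1 x /
          (x powr (2 * \<alpha>) + 2 * x powr \<alpha> * cos (\<rho> * \<alpha> * pi) + 1)))
    = 1 / ladder_exponent M X 1 \<theta>"
proof -
  define \<gamma> where "\<gamma> = arctan (\<beta> * tan (pi * \<alpha> / 2))"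
  have \<beta>: "- 1 \<le> \<beta>" "\<beta> \<le> 1" "\<alpha> = 1 \<Longrightarrow> \<beta> = 0" and M: "prob_space M"
    and X [measurable]: "\<And>t. t \<ge> 0 \<Longrightarrow> X t \<in> borel_measurable M"
    and char: "\<And>t z. t \<ge> 0 \<Longrightarrow> char (distr M borel (X t)) z = exp (- (of_real t * stable_symbol \<alpha> \<gamma> z))"
    using assms(3) unfolding strictly_stable_process_def levy_process_def stable_exponent_eq_symbol \<gamma>_def
    by blast+
  interpret M: prob_space M by (rule M)
  have \<gamma>: "\<bar>\<gamma>\<bar> < pi / 2"
    using arctan_bounded[of "\<beta> * tan (pi * \<alpha> / 2)"] by (auto simp: \<gamma>_def)
  have X': "(\<lambda>\<omega>. - X t \<omega>) \<in> borel_measurable M" if "t \<ge> 0" for t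
    using X[OF that] by measurable
  interpret S: stable_semigroup "\<lambda>t. distr M borel (X t)" \<alpha> \<gamma>
  proof (rule stable_semigroup.intro)
    show "real_distribution (distr M borel (X t))" if "t > 0" for t
      using X[of t] that by (intro M.real_distribution_distr) auto
  qed (use assms \<gamma> char in auto)
  interpret D: stable_semigroup "\<lambda>t. distr M borel (dual_process X t)" \<alpha> "- \<gamma>"
  proof (rule stable_semigroup.intro)
    fix t :: real assume t: "t > 0"
    show "real_distribution (distr M borel (dual_process X t))"
      unfolding dual_process_def using X'[of t] t by (intro M.real_distribution_distr) auto
    fix z
    have "char (distr M borel (dual_process X t)) z = char (distr M borel (X t)) (- z)"
      unfolding char_def dual_process_def using X[of t] X'[of t] t by (subst (1 2) integral_distr) auto
    then show "char (distr M borel (dual_process X t)) z = exp (- (of_real t * stable_symbol \<alpha> (- \<gamma>) z))"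
      using t by (simp add: char stable_symbol_def sgn_minus)
  qed (use assms \<gamma> in auto)
  interpret dual: stable_exp_law S.mix.dual \<alpha> "- \<gamma>" by (rule S.mix.dual_law)
  \<comment> \<open>Sampling the dual process at an exponential time and reflecting the sampled law
    of \<open>X\<close> give the same characteristic function. Both ladder exponents can therefore
    be expressed through the one law \<open>S.mix\<close>.\<close>
  have dual: "D.mix = S.mix.dual"
    by (rule Levy_uniqueness) (auto simp: D.char_mix dual.char_N intro!: D.mix.real_distribution_axioms dual.real_distribution_axioms)
  have ladder: "ladder_exponent M X 1 x = exp (Re (log_kappa \<alpha> S.mix (of_real x)))"
    "ladder_exponent M (dual_process X) 1 x = exp (Re (log_kappa \<alpha> S.mix.dual (of_real x)))" if "x > 0" for x
    using S.ladder_integral[OF that] D.ladder_integral[OF that] by (simp_all add: ladder_exponent_def dual)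
  have "\<rho> = measure (distr M borel (X 1)) {0..}"
    using X[of 1] by (simp add: assms(4) positivity_coefficient_def measure_distr vimage_def Int_def conj_commute)
  then have \<rho>: "\<rho> * \<alpha> * pi = S.mix.phi"
    using assms(1) S.mix.prob_nonneg by (simp add: S.measure_mix_nonneg S.mix.phi_def field_simps)
  have "S.mix.phi \<le> pi"
    using skew_angle_le[OF assms(1,2) \<beta>] unfolding S.mix.phi_def unfolding \<gamma>_def .
  \<comment> \<open>The skewness bound admits equality; phi = pi would mean \<rho> = 1 / \<alpha>,
    the value excluded by hypothesis.\<close>
  moreover have "S.mix.phi \<noteq> pi" using \<rho> assms(1,5) by (auto simp: field_simps)
  moreover have "S.mix.phi > 0" using \<rho> assms(1,5) by (simp add: \<rho>[symmetric])
  ultimately have phi: "0 < S.mix.phi" "S.mix.phi < pi" by auto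
  define I where "I = (LBINT x:{0<..}. 1 / (x + \<theta>) *
        (x powr \<alpha> * ladder_exponent M (dual_process X) 1 x /
          (x powr (2 * \<alpha>) + 2 * x powr \<alpha> * cos (\<rho> * \<alpha> * pi) + 1)))"
  have "pi * exp (- Re (log_kappa \<alpha> S.mix (of_real \<theta>))) = (LBINT x:{0<..}. Im (S.mix.recip_kappa_ext (of_real x)) / (x + \<theta>))"
    by (rule S.mix.stieltjes_inversion[OF assms(6) phi, symmetric])
  also have "\<dots> = (LBINT x:{0<..}. sin S.mix.phi * (1 / (x + \<theta>) *
        (x powr \<alpha> * ladder_exponent M (dual_process X) 1 x /
          (x powr (2 * \<alpha>) + 2 * x powr \<alpha> * cos (\<rho> * \<alpha> * pi) + 1))))"
    unfolding \<rho> by (intro set_lebesgue_integral_cong) (auto simp: S.mix.Im_recip_kappa_ext_of_real ladder mult_ac)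
  also have "\<dots> = sin S.mix.phi * I" by (simp only: I_def set_integral_mult_right)
  finally have "sin S.mix.phi * I = pi * exp (- Re (log_kappa \<alpha> S.mix (of_real \<theta>)))" by simp
  then have "sin (\<rho> * \<alpha> * pi) / pi * I = 1 / ladder_exponent M X 1 \<theta>"
    unfolding \<rho> ladder(1)[OF assms(6)] by (simp add: exp_minus field_simps)
  then show ?thesis by (simp only: I_def)
qed

end
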